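(* For a (real) Banach space $X$ the following conditions are equivalent: (1) The weak unit ball $B_w$ of $X$ is Fréchet-Urysohn. (2) $B_w$ contains no strong $\mathrm{Fin}^\omega$-fan. (3) $X$ contains no isomorphic copy of the Banach space $\ell_1$.
   Context: The weak unit ball $B_w$ of $X$ is the closed unit ball of $X$ endowed with the topology inherited from the weak topology of $X$. A space $Y$ is Fréchet-Urysohn if for each $A\subset Y$ and $a\in\overline A$ some sequence of points of $A$ converges to $a$. A family $(F_n)_{n\in\omega}$ of subsets of a space $Y$ is locally finite if each point of $Y$ has a neighborhood meeting $F_n$ for only finitely many $n$; it is compact-finite if each compact subset of $Y$ meets $F_n$ for only finitely many $n$. A set $U\subset Y$ is $\mathbb R$-open if for each $y\in U$ there is a continuous $f:Y\to[0,1]$ with $f(y)=1$ and $f(Y\setminus U)\subset\{0\}$. A $\mathrm{Fin}^\omega$-fan in $Y$ is a family $(F_n)_{n\in\omega}$ of finite subsets of $Y$ that is compact-finite but not locally finite; it is strong if each $F_n$ has an $\mathbb R$-open neighborhood $U_n\supset F_n$ such that $(U_n)_{n\in\omega}$ is compact-finite. *)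

theory Defs
  imports "HOL-Analysis.Analysis"
begin

typedef ell1 = "{x :: nat \<Rightarrow> real. summable (\<lambda>n. \<bar>x n\<bar>)}"
  by (rule exI[of _ "\<lambda>_. 0"]) simp

setup_lifting type_definition_ell1

instantiation ell1 :: real_vector
begin

lift_definition zero_ell1 :: ell1 is "\<lambda>_. 0" by simp

lift_definition plus_ell1 :: "ell1 \<Rightarrow> ell1 \<Rightarrow> ell1" is "\<lambda>x y n. x n + y n"
proof -
  fix x y :: "nat \<Rightarrow> real"
  assume "summable (\<lambda>n. \<bar>x n\<bar>)" "summable (\<lambda>n. \<bar>y n\<bar>)"
  from summable_add[OF this] show "summable (\<lambda>n. \<bar>x n + y n\<bar>)"
    by (rule summable_comparison_test') auto
qed

lift_definition minus_ell1 :: "ell1 \<Rightarrow> ell1 \<Rightarrow> ell1" is "\<lambda>x y n. x n - y n"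
proof -
  fix x y :: "nat \<Rightarrow> real"
  assume "summable (\<lambda>n. \<bar>x n\<bar>)" "summable (\<lambda>n. \<bar>y n\<bar>)"
  from summable_add[OF this] show "summable (\<lambda>n. \<bar>x n - y n\<bar>)"
    by (rule summable_comparison_test') auto
qed

lift_definition uminus_ell1 :: "ell1 \<Rightarrow> ell1" is "\<lambda>x n. - x n" by simp

lift_definition scaleR_ell1 :: "real \<Rightarrow> ell1 \<Rightarrow> ell1" is "\<lambda>c x n. c * x n"
  by (simp add: abs_mult summable_mult)

instance
  by standard (transfer; simp add: algebra_simps)+

end

instantiation ell1 :: real_normed_vector
begin

lift_definition norm_ell1 :: "ell1 \<Rightarrow> real" is "\<lambda>x. \<Sum>n. \<bar>x n\<bar>" .

definition dist_ell1 :: "ell1 \<Rightarrow> ell1 \<Rightarrow> real"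
  where "dist_ell1 x y = norm (x - y)"

definition sgn_ell1 :: "ell1 \<Rightarrow> ell1"
  where "sgn_ell1 x = x /\<^sub>R norm x"

definition uniformity_ell1 :: "(ell1 \<times> ell1) filter"
  where "uniformity_ell1 = (INF e\<in>{0<..}. principal {(x, y). dist x y < e})"

definition open_ell1 :: "ell1 set \<Rightarrow> bool"
  where "open_ell1 U \<longleftrightarrow> (\<forall>x\<in>U. \<forall>\<^sub>F (x', y) in uniformity. x' = x \<longrightarrow> y \<in> U)"

instance
proof
  fix x y :: ell1 and c :: real
  show "norm x = 0 \<longleftrightarrow> x = 0"
    by transfer (auto simp: suminf_eq_zero_iff fun_eq_iff)
  show "norm (x + y) \<le> norm x + norm y"
  proof transfer
    fix x y :: "nat \<Rightarrow> real"
    assume s: "summable (\<lambda>n. \<bar>x n\<bar>)" "summable (\<lambda>n. \<bar>y n\<bar>)"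
    have "(\<Sum>n. \<bar>x n + y n\<bar>) \<le> (\<Sum>n. \<bar>x n\<bar> + \<bar>y n\<bar>)"
      by (intro suminf_le summable_add s summable_comparison_test'[OF summable_add[OF s]]) auto
    then show "(\<Sum>n. \<bar>x n + y n\<bar>) \<le> (\<Sum>n. \<bar>x n\<bar>) + (\<Sum>n. \<bar>y n\<bar>)"
      using suminf_add[OF s] by simp
  qed
  show "norm (c *\<^sub>R x) = \<bar>c\<bar> * norm x"
    by transfer (simp add: abs_mult suminf_mult)
qed (simp_all add: dist_ell1_def sgn_ell1_def uniformity_ell1_def open_ell1_def)

end

instance ell1 :: banach
proof
  fix X :: "nat \<Rightarrow> ell1"
  assume X: "Cauchy X"
  have le: "(\<Sum>k<K. \<bar>Rep_ell1 x k\<bar>) \<le> norm x" for K and x :: ell1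
    by transfer (simp add: sum_le_suminf)
  have le1: "\<bar>Rep_ell1 x k\<bar> \<le> norm x" for k and x :: ell1
    proof -
    have "0 \<le> (\<Sum>k<k. \<bar>Rep_ell1 x k\<bar>)" by (rule sum_nonneg) simp
    with le[of x "Suc k"] show ?thesis unfolding sum.lessThan_Suc by linarith
  qed
  have dif: "Rep_ell1 (x - y) k = Rep_ell1 x k - Rep_ell1 y k" for x y k
    by transfer simp
  have "Cauchy (\<lambda>n. Rep_ell1 (X n) k)" for k
  proof (rule metric_CauchyI)
    fix e :: real
    assume "0 < e"
    then obtain M where "\<And>m n. m \<ge> M \<Longrightarrow> n \<ge> M \<Longrightarrow> dist (X m) (X n) < e"
      using X by (metis metric_CauchyD)
    then show "\<exists>M. \<forall>m\<ge>M. \<forall>n\<ge>M. dist (Rep_ell1 (X m) k) (Rep_ell1 (X n) k) < e"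
      using le1[of "X _ - X _" k] unfolding dist_norm real_norm_def dif
      by (meson order_le_less_trans)
  qed
  then have "\<exists>l. (\<lambda>n. Rep_ell1 (X n) k) \<longlonglongrightarrow> l" for k
    by (simp add: Cauchy_convergent_iff convergent_def)
  then obtain l where l: "\<And>k. (\<lambda>n. Rep_ell1 (X n) k) \<longlonglongrightarrow> l k"
    by metis
  have bound: "\<exists>M. \<forall>m\<ge>M. \<forall>K. (\<Sum>k<K. \<bar>Rep_ell1 (X m) k - l k\<bar>) \<le> e" if "e > 0" for e
  proof -
    obtain M where M: "\<And>m n. m \<ge> M \<Longrightarrow> n \<ge> M \<Longrightarrow> norm (X m - X n) < e"
      using X \<open>e > 0\<close> by (metis metric_CauchyD dist_norm)
    have "(\<Sum>k<K. \<bar>Rep_ell1 (X m) k - l k\<bar>) \<le> e" if m: "m \<ge> M" for m K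
    proof (rule tendsto_upperbound)
      show "(\<lambda>n. \<Sum>k<K. \<bar>Rep_ell1 (X m) k - Rep_ell1 (X n) k\<bar>)
              \<longlonglongrightarrow> (\<Sum>k<K. \<bar>Rep_ell1 (X m) k - l k\<bar>)"
        by (intro tendsto_intros l)
      show "\<forall>\<^sub>F n in sequentially. (\<Sum>k<K. \<bar>Rep_ell1 (X m) k - Rep_ell1 (X n) k\<bar>) \<le> e"
        unfolding eventually_sequentially
        using le[of "X m - X _" K] M[OF m] unfolding dif by (meson less_imp_le order_trans)
    qed simp
    then show ?thesis by blast
  qed
  have sm: "summable (\<lambda>k. \<bar>Rep_ell1 (X m) k - l k\<bar>)"
    if "\<And>K. (\<Sum>k<K. \<bar>Rep_ell1 (X m) k - l k\<bar>) \<le> e" for m e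
    using that by (intro summableI_nonneg_bounded[of _ e]) auto
  obtain M where M: "\<And>K. (\<Sum>k<K. \<bar>Rep_ell1 (X M) k - l k\<bar>) \<le> 1"
    using bound[of 1] by auto
  have "summable (\<lambda>k. \<bar>Rep_ell1 (X M) k\<bar>)"
    using Rep_ell1 by auto
  from summable_add[OF this sm[OF M]] have "summable (\<lambda>k. \<bar>l k\<bar>)"
    by (rule summable_comparison_test') auto
  then have L: "Rep_ell1 (Abs_ell1 l) = l"
    by (simp add: Abs_ell1_inverse)
  have "X \<longlonglongrightarrow> Abs_ell1 l"
  proof (rule metric_LIMSEQ_I)
    fix r :: real
    assume "0 < r"
    then obtain N where N: "\<And>m K. m \<ge> N \<Longrightarrow> (\<Sum>k<K. \<bar>Rep_ell1 (X m) k - l k\<bar>) \<le> r / 2"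
      using bound[of "r / 2"] by auto
    have "dist (X m) (Abs_ell1 l) < r" if "m \<ge> N" for m
    proof -
      have "norm (X m - Abs_ell1 l) = (\<Sum>k. \<bar>Rep_ell1 (X m) k - l k\<bar>)"
        unfolding norm_ell1.rep_eq dif L ..
      also have "\<dots> \<le> r / 2"
        by (intro suminf_le_const sm[OF N[OF that]] N[OF that])
      finally show ?thesis
        using \<open>0 < r\<close> by (simp add: dist_norm)
    qed
    then show "\<exists>N. \<forall>m\<ge>N. dist (X m) (Abs_ell1 l) < r" by blast
  qed
  then show "convergent X"
    by (auto simp: convergent_def)
qed

definition isomorphic_copy ::
    "'b::real_normed_vector itself \<Rightarrow> 'a::real_normed_vector set \<Rightarrow> bool"
  where "isomorphic_copy _ S \<longleftrightarrow>
    subspace S \<and>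
    (\<exists>(T :: 'b \<Rightarrow> 'a) T'. linear T \<and> homeomorphism UNIV S T T')"

definition weak_topology :: "'a::real_normed_vector topology"
  where "weak_topology =
    topology_generated_by {f -` U |(f :: 'a \<Rightarrow> real) U. bounded_linear f \<and> open U}"

definition weak_unit_ball :: "'a::real_normed_vector topology"
  where "weak_unit_ball = subtopology weak_topology (cball 0 1)"

definition frechet_urysohn_space :: "'a topology \<Rightarrow> bool"
  where "frechet_urysohn_space Y \<longleftrightarrow>
    (\<forall>A a. A \<subseteq> topspace Y \<and> a \<in> Y closure_of A \<longrightarrow>
      (\<exists>s. range s \<subseteq> A \<and> limitin Y s a sequentially))"

(* The families are indexed, so a set occurring for infinitely many indices counts
   infinitely often, unlike for the library's locally_finite_in on sets of sets. *)

definition locally_finite_family :: "'a topology \<Rightarrow> (nat \<Rightarrow> 'a set) \<Rightarrow> bool"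
  where "locally_finite_family Y F \<longleftrightarrow>
    (\<forall>y\<in>topspace Y. \<exists>V. openin Y V \<and> y \<in> V \<and> finite {n. F n \<inter> V \<noteq> {}})"

definition compact_finite_family :: "'a topology \<Rightarrow> (nat \<Rightarrow> 'a set) \<Rightarrow> bool"
  where "compact_finite_family Y F \<longleftrightarrow>
    (\<forall>K. compactin Y K \<longrightarrow> finite {n. F n \<inter> K \<noteq> {}})"

definition R_open :: "'a topology \<Rightarrow> 'a set \<Rightarrow> bool"
  where "R_open Y U \<longleftrightarrow>
    U \<subseteq> topspace Y \<and>
    (\<forall>y\<in>U. \<exists>f. continuous_map Y (top_of_set {0..1::real}) f \<and>
      f y = 1 \<and> f ` (topspace Y - U) \<subseteq> {0})"

definition Fin_omega_fan :: "'a topology \<Rightarrow> (nat \<Rightarrow> 'a set) \<Rightarrow> bool"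
  where "Fin_omega_fan Y F \<longleftrightarrow>
    (\<forall>n. F n \<subseteq> topspace Y \<and> finite (F n)) \<and>
    compact_finite_family Y F \<and> \<not> locally_finite_family Y F"

definition strong_Fin_omega_fan :: "'a topology \<Rightarrow> (nat \<Rightarrow> 'a set) \<Rightarrow> bool"
  where "strong_Fin_omega_fan Y F \<longleftrightarrow>
    Fin_omega_fan Y F \<and>
    (\<exists>U. (\<forall>n. R_open Y (U n) \<and> F n \<subseteq> U n) \<and> compact_finite_family Y U)"

end

theory Submission
  imports Defs
begin

text \<open>If the weak unit ball is Frechet--Urysohn, a fan that is not locally finite at a point yields a
  sequence converging to that point and meeting infinitely many members, against compact-finiteness.

  If \<open>\<ell>\<^sub>1\<close> does not embed, a point of the weak closure of a set is, by weak-star compactness of the dual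
  ball, an ultrafilter limit of a sequence of the set. Rosenthal's argument, run with the sets of the
  ultrafilter as the large sets, then gives a weakly convergent subsequence.

  If \<open>x\<close> is an \<open>\<ell>\<^sub>1\<close>-sequence, the sets \<open>{x n - x i | i < n}\<close> form a strong fan: by a pigeonhole argument
  they accumulate weakly at \<open>0\<close>. They are separated by functionals \<open>\<phi> n\<close> biorthogonal to \<open>x\<close>, which are
  obtained as Rademacher averages of functionals realising all sign patterns on \<open>x\<close>. These
  averages are uniformly small along a weakly null sequence. For points \<open>y\<close> of a weakly compact set
  with \<open>\<bar>\<phi> n y\<bar> > 1/2\<close>, the dichotomy together with Grothendieck's double limit
  criterion therefore excludes infinitely many \<open>n\<close>.\<close>

section \<open>Ultrafilters\<close>

text \<open>Rosenthal's theorem alone gives weakly Cauchy subsequences, whose limit need not be the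
  prescribed point, nor lie in the space at all. Selecting all terms from sets of one ultrafilter
  along which \<open>s n - a\<close> is weakly null ties the limit to \<open>a\<close>; the price is
  that "infinite" must be replaced by a notion of largeness adapted to the ultrafilter. In the other
  direction the neighbourhoods, and not only the fan, must be compact-finite. Hahn-Banach
  functionals are merely bounded, and even a weak-star null sequence of functionals can be large
  along a weakly compact set, as the coordinates of a Hilbert space show on its basis. What is
  needed is that \<open>y\<close> be mapped to the sequence of its values \<open>\<phi> n y\<close>
  by a completely continuous operator. Rademacher coefficients of the function sending
  \<open>A\<close> to \<open>f A y\<close> provide it: in the mean over \<open>A\<close> these
  functions tend to 0 when \<open>y\<close> runs through a weakly null sequence.\<close>

definition ultra :: "'a filter \<Rightarrow> bool" where
  "ultra V \<longleftrightarrow> V \<noteq> bot \<and> (\<forall>P. eventually P V \<or> eventually (\<lambda>x. \<not> P x) V)"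

lemma ultra_nonbot: "ultra V \<Longrightarrow> V \<noteq> bot"
  by (simp add: ultra_def)

lemma ultra_not_eventually: "ultra V \<Longrightarrow> \<not> eventually P V \<longleftrightarrow> eventually (\<lambda>x. \<not> P x) V"
proof
  assume V: "ultra V" and "eventually (\<lambda>x. \<not> P x) V"
  show "\<not> eventually P V"
  proof
    assume "eventually P V"
    with \<open>eventually (\<lambda>x. \<not> P x) V\<close> have "eventually (\<lambda>x. False) V"
      by eventually_elim simp
    with V show False by (simp add: ultra_def)
  qed
qed (auto simp: ultra_def)

text \<open>Zorn's lemma for the proper filters below \<open>F\<close>: a chain is directed, so an
  event of its infimum is already an event of a member, and the infimum stays proper. A minimal
  \<open>m\<close> decides every \<open>P\<close>: if \<open>m\<close> does not exclude
  \<open>P\<close>, its restriction to \<open>P\<close> is proper and hence equal to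
  \<open>m\<close>.\<close>

lemma ultra_exists:
  fixes F :: "'a filter"
  assumes "F \<noteq> bot"
  obtains V where "V \<le> F" "ultra V"
proof -
  define A where "A = {G. G \<noteq> bot \<and> G \<le> F}"
  have "\<exists>m\<in>A. \<forall>a\<in>A. m \<ge> a \<longrightarrow> a = m"
  proof (rule predicate_Zorn)
    show "partial_order_on A (relation_of (\<ge>) A)"
      by (rule partial_order_on_relation_ofI) auto
    fix C assume C: "C \<in> Chains (relation_of (\<ge>) A)"
    then have CA: "C \<subseteq> A" and tot: "\<And>a b. a \<in> C \<Longrightarrow> b \<in> C \<Longrightarrow> a \<le> b \<or> b \<le> a"
      by (auto simp: Chains_def relation_of_def)
    show "\<exists>u\<in>A. \<forall>a\<in>C. a \<ge> u"
    proof (cases "C = {}")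
      case True
      then show ?thesis using assms by (auto simp: A_def)
    next
      case False
      have "eventually P (Inf C) \<longleftrightarrow> (\<exists>b\<in>C. eventually P b)" for P
        by (rule eventually_Inf_base) (use False tot in \<open>auto simp: inf_absorb1 inf_absorb2\<close>)
      then have "Inf C \<noteq> bot"
        using CA by (auto simp: trivial_limit_def A_def)
      moreover have "Inf C \<le> F"
        using False CA by (auto simp: A_def intro: Inf_lower2)
      ultimately show ?thesis
        by (auto simp: A_def intro!: bexI[of _ "Inf C"] Inf_lower)
    qed
  qed
  then obtain m where m: "m \<noteq> bot" "m \<le> F" and max: "\<And>G. G \<noteq> bot \<Longrightarrow> G \<le> F \<Longrightarrow> G \<le> m \<Longrightarrow> G = m"
    by (auto simp: A_def)
  have "eventually P m \<or> eventually (\<lambda>x. \<not> P x) m" for P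
  proof (rule disjCI)
    assume "\<not> eventually (\<lambda>x. \<not> P x) m"
    then have "inf m (principal {x. P x}) \<noteq> bot"
      by (auto simp: trivial_limit_def eventually_inf_principal)
    then have "m = inf m (principal {x. P x})"
      using m(2) by (intro max[symmetric]) (auto intro: le_infI1)
    moreover have "eventually P (inf m (principal {x. P x}))"
      by (simp add: eventually_inf_principal)
    ultimately show "eventually P m" by simp
  qed
  then show ?thesis
    using that[of m] m by (auto simp: ultra_def)
qed

lemma ultra_tendsto_compact:
  fixes f :: "'a \<Rightarrow> 'b::topological_space"
  assumes V: "ultra V" and K: "compact K" "eventually (\<lambda>x. f x \<in> K) V"
  obtains l where "l \<in> K" "(f \<longlongrightarrow> l) V"
proof (rule ccontr)
  assume "\<not> thesis"
  then have "\<forall>l\<in>K. \<exists>S. open S \<and> l \<in> S \<and> \<not> eventually (\<lambda>x. f x \<in> S) V"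
    using that unfolding tendsto_def by blast
  then obtain S where S: "\<And>l. l \<in> K \<Longrightarrow> open (S l) \<and> l \<in> S l \<and> \<not> eventually (\<lambda>x. f x \<in> S l) V"
    by metis
  then obtain D where D: "D \<subseteq> K" "finite D" "K \<subseteq> (\<Union>l\<in>D. S l)"
    using compactE_image[OF K(1), of K S] by (metis UN_iff subsetI)
  have "eventually (\<lambda>x. \<forall>l\<in>D. f x \<notin> S l) V"
    using D S ultra_not_eventually[OF V] by (auto intro!: eventually_ball_finite)
  with K(2) have "eventually (\<lambda>x. False) V"
    by eventually_elim (use D in auto)
  then show False
    using V by (simp add: ultra_def)
qed

lemma ultra_tendsto_bounded:
  fixes f :: "'a \<Rightarrow> real"
  assumes "ultra V" "\<And>x. \<bar>f x\<bar> \<le> C"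
  obtains l where "\<bar>l\<bar> \<le> C" "(f \<longlongrightarrow> l) V"
proof (rule ultra_tendsto_compact[of V "{-C..C}" f])
  show "eventually (\<lambda>x. f x \<in> {- C..C}) V"
    using assms(2) by (simp add: abs_le_iff minus_le_iff)
next
  fix l assume "l \<in> {-C..C}" "(f \<longlongrightarrow> l) V"
  then show thesis using that[of l] by (simp add: abs_le_iff)
qed (use assms(1) in auto)

lemma ultra_sequentially_infinite:
  assumes "V \<le> sequentially" "V \<noteq> bot" "eventually P V"
  shows "infinite {n. P n}"
proof
  assume "finite {n. P n}"
  then have "eventually (\<lambda>n. \<not> P n) sequentially"
    by (simp add: eventually_cofinite flip: cofinite_eq_sequentially)
  then have "eventually (\<lambda>n. \<not> P n) V"
    using assms(1) by (rule filter_leD[rotated])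
  with assms(3) have "eventually (\<lambda>x. False) V"
    by eventually_elim auto
  then show False using assms(2) by simp
qed

section \<open>The Hahn--Banach theorem\<close>

text \<open>Positive homogeneity is asked only as an inequality, which is the direction that the
  infima below deliver; scaling by \<open>1/t\<close> recovers equality in
  \<open>sublinear_scale\<close>.\<close>

definition sublinear :: "('a::real_vector \<Rightarrow> real) \<Rightarrow> bool" where
  "sublinear q \<longleftrightarrow> (\<forall>x y. q (x + y) \<le> q x + q y) \<and> (\<forall>t x. t \<ge> 0 \<longrightarrow> q (t *\<^sub>R x) \<le> t * q x)"

lemma sublinear_add: "sublinear q \<Longrightarrow> q (x + y) \<le> q x + q y"
  by (simp add: sublinear_def)

lemma sublinear_0: "sublinear q \<Longrightarrow> q 0 = 0"
proof -
  assume q: "sublinear q"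
  then have "q (0 *\<^sub>R 0) \<le> 0 * q 0"
    unfolding sublinear_def by blast
  then show ?thesis
    using sublinear_add[OF q, of 0 0] by simp
qed

lemma sublinear_scale:
  assumes "sublinear q" "t \<ge> 0"
  shows "q (t *\<^sub>R x) = t * q x"
proof (cases "t = 0")
  case False
  then have "q ((1/t) *\<^sub>R t *\<^sub>R x) \<le> (1/t) * q (t *\<^sub>R x)"
    using assms unfolding sublinear_def by (meson divide_nonneg_nonneg zero_le_one)
  then have "t * q x \<le> q (t *\<^sub>R x)"
    using assms False by (simp add: field_simps)
  then show ?thesis
    using assms unfolding sublinear_def by (meson antisym)
qed (use sublinear_0[OF assms(1)] in simp)

lemma sublinear_minus: "sublinear q \<Longrightarrow> - q (- x) \<le> q x"
  using sublinear_add[of q x "-x"] sublinear_0[of q] by simp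

lemma sublinear_minimal_linear:
  assumes q: "sublinear q"
    and min: "\<And>q'. sublinear q' \<Longrightarrow> (\<And>x. q' x \<le> q x) \<Longrightarrow> q' = q"
  shows "linear q"
proof -
  have super: "q x + q y \<le> q (x + y)" for x y
  proof -
    \<comment> \<open>The infimum \<open>q'\<close> is sublinear and below \<open>q\<close>; minimality turns \<open>q' x \<le> g x 1\<close> into superadditivity.\<close>
    define g where "g x t = q (x + t *\<^sub>R y) - t * q y" for x t
    define q' where "q' x = (INF t\<in>{0..}. g x t)" for x
    have bdd: "bdd_below (g x ` {0..})" for x
    proof (rule bdd_belowI2)
      fix t :: real assume "t \<in> {0..}"
      then have "t * q y = q ((x + t *\<^sub>R y) + - x)"
        using sublinear_scale[OF q] by simp
      also have "\<dots> \<le> q (x + t *\<^sub>R y) + q (- x)"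
        by (rule sublinear_add[OF q])
      finally show "- q (- x) \<le> g x t"
        by (simp add: g_def)
    qed
    have le: "q' x \<le> g x t" if "t \<ge> 0" for x t
      unfolding q'_def by (rule cINF_lower[OF bdd]) (use that in simp)
    have ge: "c \<le> q' x" if "\<And>t. t \<ge> 0 \<Longrightarrow> c \<le> g x t" for x c
      unfolding q'_def by (rule cINF_greatest) (use that in auto)
    have "sublinear q'"
      unfolding sublinear_def
    proof (intro conjI allI impI)
      fix x z
      have *: "q' (x + z) \<le> g x s + g z t" if "s \<ge> 0" "t \<ge> 0" for s t
      proof -
        have "q' (x + z) \<le> g (x + z) (s + t)"
          using that by (intro le) auto
        also have "\<dots> \<le> g x s + g z t"
          using sublinear_add[OF q, of "x + s *\<^sub>R y" "z + t *\<^sub>R y"]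
          by (simp add: g_def algebra_simps)
        finally show ?thesis .
      qed
      have "q' (x + z) - g x s \<le> q' z" if "s \<ge> 0" for s
        by (rule ge) (use *[OF that] in \<open>simp add: algebra_simps\<close>)
      then have "q' (x + z) - q' z \<le> q' x"
        by (intro ge) (simp add: algebra_simps)
      then show "q' (x + z) \<le> q' x + q' z" by simp
    next
      fix c x assume c: "(0::real) \<le> c"
      show "q' (c *\<^sub>R x) \<le> c * q' x"
      proof (cases "c = 0")
        case True
        then show ?thesis
          using le[of 0 0] sublinear_0[OF q] by (simp add: g_def)
      next
        case False
        have "q' (c *\<^sub>R x) / c \<le> q' x"
        proof (rule ge)
          fix t :: real assume "t \<ge> 0"
          have "q' (c *\<^sub>R x) \<le> g (c *\<^sub>R x) (c * t)"
            using c \<open>t \<ge> 0\<close> by (intro le) auto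
          also have "\<dots> = q (c *\<^sub>R (x + t *\<^sub>R y)) - c * (t * q y)"
            by (simp add: g_def algebra_simps)
          also have "\<dots> = c * g x t"
            unfolding sublinear_scale[OF q c] by (simp add: g_def algebra_simps)
          finally show "q' (c *\<^sub>R x) / c \<le> g x t"
            using c False by (simp add: field_simps)
        qed
        then show ?thesis
          using c False by (simp add: field_simps)
      qed
    qed
    moreover have "q' x \<le> q x" for x
      using le[of 0 x] by (simp add: g_def)
    ultimately have "q' = q" by (rule min)
    then show ?thesis
      using le[of 1 x] by (simp add: g_def)
  qed
  have add: "q (x + y) = q x + q y" for x y
    using super sublinear_add[OF q] by (simp add: antisym)
  have neg: "q (- x) = - q x" for x
    using add[of x "-x"] sublinear_0[OF q] by simp
  show ?thesis
  proof (rule linearI)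
    show "q (t *\<^sub>R x) = t *\<^sub>R q x" for t x
      using sublinear_scale[OF q, of t x] sublinear_scale[OF q, of "-t" x] neg[of "t *\<^sub>R x"]
      by (cases "t \<ge> 0") auto
  qed (rule add)
qed

text \<open>Zorn's lemma yields a minimal sublinear functional below \<open>p\<close>, and
  minimality forces linearity. The pointwise infimum of a chain is subadditive because any two
  members have a lower one in the chain.\<close>

lemma sublinear_dominates_linear:
  fixes p :: "'a::real_vector \<Rightarrow> real"
  assumes p: "sublinear p"
  obtains f where "linear f" "\<And>x. f x \<le> p x"
proof -
  define A where "A = {q. sublinear q \<and> q \<le> p}"
  have "\<exists>m\<in>A. \<forall>a\<in>A. m \<ge> a \<longrightarrow> a = m"
  proof (rule predicate_Zorn)
    show "partial_order_on A (relation_of (\<ge>) A)"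
      by (rule partial_order_on_relation_ofI) auto
    fix C assume "C \<in> Chains (relation_of (\<ge>) A)"
    then have CA: "C \<subseteq> A" and tot: "\<And>a b. a \<in> C \<Longrightarrow> b \<in> C \<Longrightarrow> a \<le> b \<or> b \<le> a"
      by (auto simp: Chains_def relation_of_def)
    show "\<exists>u\<in>A. \<forall>a\<in>C. a \<ge> u"
    proof (cases "C = {}")
      case True
      then show ?thesis using p by (auto simp: A_def)
    next
      case False
      define u where "u x = (INF q\<in>C. q x)" for x
      have sub: "sublinear q" and qp: "q x \<le> p x" if "q \<in> C" for q x
        using CA that by (auto simp: A_def le_fun_def)
      \<comment> \<open>From \<open>0 \<le> q x + q (- x)\<close> and \<open>q \<le> p\<close> all
        members share a lower bound that does not depend on \<open>q\<close>.\<close>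
      have bdd: "bdd_below ((\<lambda>q. q x) ` C)" for x
      proof (rule bdd_belowI2)
        fix q assume "q \<in> C"
        then show "- p (- x) \<le> q x"
          using sublinear_minus[OF sub, of q x] qp[of q "- x"] by linarith
      qed
      have le: "u x \<le> q x" if "q \<in> C" for x q
        unfolding u_def by (rule cINF_lower[OF bdd that])
      have ge: "c \<le> u x" if "\<And>q. q \<in> C \<Longrightarrow> c \<le> q x" for x c
        unfolding u_def using False that by (rule cINF_greatest)
      have "sublinear u"
        unfolding sublinear_def
      proof (intro conjI allI impI)
        fix x z
        have *: "u (x + z) \<le> q x + r z" if "q \<in> C" "r \<in> C" for q r
        proof -
          obtain s where s: "s \<in> C" "s \<le> q" "s \<le> r"
            using tot[OF \<open>q \<in> C\<close> \<open>r \<in> C\<close>] \<open>q \<in> C\<close> \<open>r \<in> C\<close> by blast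
          have "u (x + z) \<le> s (x + z)" by (rule le[OF s(1)])
          also have "\<dots> \<le> s x + s z" by (rule sublinear_add[OF sub[OF s(1)]])
          also have "\<dots> \<le> q x + r z"
            using s by (intro add_mono) (auto simp: le_fun_def)
          finally show ?thesis .
        qed
        have "u (x + z) - q x \<le> u z" if "q \<in> C" for q
          by (rule ge) (use *[OF that] in \<open>simp add: algebra_simps\<close>)
        then have "u (x + z) - u z \<le> u x"
          by (intro ge) (simp add: algebra_simps)
        then show "u (x + z) \<le> u x + u z" by simp
      next
        fix c x assume c: "(0::real) \<le> c"
        have *: "u (c *\<^sub>R x) \<le> c * q x" if "q \<in> C" for q
          using le[OF that, of "c *\<^sub>R x"] sublinear_scale[OF sub[OF that] c, of x] by simp
        show "u (c *\<^sub>R x) \<le> c * u x"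
        proof (cases "c = 0")
          case True
          then show ?thesis using * False by auto
        next
          case nz: False
          then have "u (c *\<^sub>R x) / c \<le> u x"
            using * c by (intro ge) (simp add: field_simps)
          then show ?thesis using c nz by (simp add: field_simps)
        qed
      qed
      moreover have "u \<le> p"
      proof (rule le_funI)
        fix x
        obtain q where "q \<in> C" using False by blast
        then show "u x \<le> p x"
          using le[of q x] qp[of q x] by linarith
      qed
      ultimately have "u \<in> A" by (simp add: A_def)
      then show ?thesis
        using le by (intro bexI[of _ u]) (auto simp: le_fun_def)
    qed
  qed
  then obtain m where m: "sublinear m" "m \<le> p" and min: "\<And>q. sublinear q \<Longrightarrow> q \<le> p \<Longrightarrow> q \<le> m \<Longrightarrow> q = m"
    by (auto simp: A_def)
  have "linear m"
  proof (rule sublinear_minimal_linear[OF m(1)])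
    fix q' assume "sublinear q'" "\<And>x. q' x \<le> m x"
    moreover from this(2) have "q' \<le> m" by (simp add: le_funI)
    ultimately show "q' = m" using min m(2) order_trans by blast
  qed
  with m(2) show ?thesis
    by (intro that[of m]) (auto simp: le_fun_def)
qed

text \<open>The constant stays visible, unlike in \<open>bounded_linear\<close>, because ultralimits
  are taken inside a dual ball of fixed radius.\<close>

definition bdd_functional :: "real \<Rightarrow> ('a::real_normed_vector \<Rightarrow> real) \<Rightarrow> bool" where
  "bdd_functional C f \<longleftrightarrow> linear f \<and> (\<forall>x. \<bar>f x\<bar> \<le> C * norm x)"

text \<open>A functional on a subspace is given by its graph \<open>W\<close>.\<close>

theorem hahn_banach:
  fixes W :: "('a::real_normed_vector \<times> real) set"
  assumes W: "subspace W" and C: "C \<ge> 0" and bound: "\<And>w r. (w, r) \<in> W \<Longrightarrow> r \<le> C * norm w"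
  obtains f where "bdd_functional C f" "\<And>w r. (w, r) \<in> W \<Longrightarrow> f w = r"
proof -
  \<comment> \<open>The infimum of \<open>g\<close> is the largest sublinear functional below
    \<open>C * norm x\<close> that is at most \<open>r\<close> at \<open>w\<close> for each
    \<open>(w, r)\<close> in \<open>W\<close>. Since \<open>W\<close> is closed under negation, a
    linear functional below it must agree with the graph.\<close>
  define g where "g x p = C * norm (x - fst p) + snd p" for x and p :: "'a \<times> real"
  define q where "q x = (INF p\<in>W. g x p)" for x
  have neg: "(-w, -r) \<in> W" if "(w, r) \<in> W" for w r
    using subspace_neg[OF W that] by simp
  have lower: "- (C * norm x) \<le> g x p" if "p \<in> W" for x p
  proof -
    obtain w r where p: "p = (w, r)" by (cases p)
    have "- r \<le> C * norm w"
      using bound[of "-w" "-r"] neg that p by auto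
    also have "\<dots> \<le> C * (norm x + norm (x - w))"
      using C by (intro mult_left_mono) (metis add.commute norm_minus_commute norm_triangle_sub)
    finally show ?thesis by (simp add: g_def p algebra_simps)
  qed
  then have bdd: "bdd_below (g x ` W)" for x
    by (rule bdd_belowI2)
  have le: "q x \<le> g x p" if "p \<in> W" for x p
    unfolding q_def by (rule cINF_lower[OF bdd that])
  have ne: "W \<noteq> {}" using subspace_0[OF W] by auto
  have ge: "c \<le> q x" if "\<And>p. p \<in> W \<Longrightarrow> c \<le> g x p" for x c
    unfolding q_def using ne that by (rule cINF_greatest)
  have "sublinear q"
    unfolding sublinear_def
  proof (intro conjI allI impI)
    fix x z
    have *: "q (x + z) \<le> g x p + g z p'" if "p \<in> W" "p' \<in> W" for p p'
    proof -
      have "q (x + z) \<le> g (x + z) (p + p')"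
        by (intro le subspace_add[OF W] that)
      also have "\<dots> \<le> C * (norm (x - fst p) + norm (z - fst p')) + snd p + snd p'"
        using mult_left_mono[OF norm_triangle_ineq[of "x - fst p" "z - fst p'"] C]
        by (simp add: g_def algebra_simps)
      finally show ?thesis by (simp add: g_def algebra_simps)
    qed
    have "q (x + z) - g x p \<le> q z" if "p \<in> W" for p
      by (rule ge) (use *[OF that] in \<open>simp add: algebra_simps\<close>)
    then have "q (x + z) - q z \<le> q x"
      by (intro ge) (simp add: algebra_simps)
    then show "q (x + z) \<le> q x + q z" by simp
  next
    fix c x assume c: "(0::real) \<le> c"
    have *: "q (c *\<^sub>R x) \<le> c * g x p" if "p \<in> W" for p
    proof -
      have "q (c *\<^sub>R x) \<le> g (c *\<^sub>R x) (c *\<^sub>R p)"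
        by (intro le subspace_scale[OF W] that)
      also have "\<dots> = C * norm (c *\<^sub>R (x - fst p)) + c * snd p"
        by (simp add: g_def algebra_simps)
      also have "\<dots> = c * g x p"
        unfolding norm_scaleR using c by (simp add: g_def algebra_simps)
      finally show ?thesis .
    qed
    show "q (c *\<^sub>R x) \<le> c * q x"
    proof (cases "c = 0")
      case True
      then show ?thesis using * ne by auto
    next
      case nz: False
      then have "q (c *\<^sub>R x) / c \<le> q x"
        using * c by (intro ge) (simp add: field_simps)
      then show ?thesis using c nz by (simp add: field_simps)
    qed
  qed
  then obtain f where f: "linear f" and fq: "\<And>x. f x \<le> q x"
    by (rule sublinear_dominates_linear) blast
  have up: "f x \<le> C * norm x" for x
    using fq[of x] le[of 0 x] subspace_0[OF W] by (simp add: g_def)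
  have "\<bar>f x\<bar> \<le> C * norm x" for x
    using up[of x] up[of "-x"] linear_neg[OF f, of x] by auto
  with f have "bdd_functional C f"
    by (simp add: bdd_functional_def)
  moreover have "f w = r" if "(w, r) \<in> W" for w r
  proof (rule antisym)
    show "f w \<le> r"
      using fq[of w] le[OF that, of w] by (simp add: g_def)
    have "f (- w) \<le> - r"
      using fq[of "-w"] le[OF neg[OF that], of "-w"] by (simp add: g_def)
    then show "r \<le> f w"
      using linear_neg[OF f, of w] by simp
  qed
  ultimately show ?thesis by (rule that)
qed

lemma bdd_functional_bounded_linear: "bdd_functional C f \<Longrightarrow> bounded_linear f"
  unfolding bdd_functional_def
  by (rule bounded_linear_intro[where K = C])
     (auto simp: linear_add linear_scale mult.commute)

lemma bounded_linear_bdd_functional: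
  fixes f :: "'a::real_normed_vector \<Rightarrow> real"
  assumes "bounded_linear f"
  obtains C where "C > 0" "bdd_functional C f"
  using bounded_linear.pos_bounded[OF assms] bounded_linear.linear[OF assms]
  by (auto simp: bdd_functional_def mult.commute)

lemma bdd_functional_abs_le: "bdd_functional C f \<Longrightarrow> \<bar>f x\<bar> \<le> C * norm x"
  by (simp add: bdd_functional_def)

lemma bdd_functional_linear: "bdd_functional C f \<Longrightarrow> linear f"
  by (simp add: bdd_functional_def)

lemma bdd_functional_scale:
  "bdd_functional C f \<Longrightarrow> bdd_functional (\<bar>t\<bar> * C) (\<lambda>x. t * f x)"
  using mult_left_mono[OF _ abs_ge_zero[of t]] unfolding bdd_functional_def
  by (auto simp: linear_iff distrib_left abs_mult mult.assoc)

lemma bdd_functional_minus: "bdd_functional C f \<Longrightarrow> bdd_functional C (\<lambda>x. - f x)"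
  using bdd_functional_scale[of C f "-1"] by simp

text \<open>This is the Banach--Alaoglu theorem in terms of ultrafilters.\<close>

lemma bdd_functional_ultralimit:
  assumes V: "ultra V" and f: "\<And>i. bdd_functional C (f i)"
  obtains g where "bdd_functional C g" "\<And>x. ((\<lambda>i. f i x) \<longlongrightarrow> g x) V"
proof -
  have "\<exists>l. \<bar>l\<bar> \<le> C * norm x \<and> ((\<lambda>i. f i x) \<longlongrightarrow> l) V" for x
    using ultra_tendsto_bounded[OF V, of "\<lambda>i. f i x" "C * norm x"] bdd_functional_abs_le[OF f]
    by metis
  then obtain g where g: "\<And>x. \<bar>g x\<bar> \<le> C * norm x" "\<And>x. ((\<lambda>i. f i x) \<longlongrightarrow> g x) V"
    by metis
  note unique = tendsto_unique[OF ultra_nonbot[OF V] g(2)]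
  have "linear g"
  proof (rule linearI)
    fix x y
    have "((\<lambda>i. f i x + f i y) \<longlongrightarrow> g x + g y) V"
      by (intro tendsto_intros g)
    then show "g (x + y) = g x + g y"
      by (intro unique) (simp add: linear_add[OF bdd_functional_linear[OF f]])
  next
    fix t x
    have "((\<lambda>i. t * f i x) \<longlongrightarrow> t * g x) V"
      by (intro tendsto_intros g)
    then show "g (t *\<^sub>R x) = t *\<^sub>R g x"
      by (intro unique) (simp add: linear_scale[OF bdd_functional_linear[OF f]])
  qed
  then show ?thesis
    using that[of g] g by (simp add: bdd_functional_def)
qed

lemma functional_separates_0:
  fixes x :: "'a::real_normed_vector"
  assumes "x \<noteq> 0"
  obtains f :: "'a \<Rightarrow> real" where "bounded_linear f" "f x \<noteq> 0"
proof -
  have bound: "r \<le> 1 * norm w" if wr: "(w, r) \<in> span {(x, norm x)}" for w r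
  proof -
    obtain t where "(w, r) = t *\<^sub>R (x, norm x)"
      using wr by (auto simp: span_singleton)
    then have "w = t *\<^sub>R x" "r = t * norm x" by auto
    then show ?thesis
      by (simp add: mult_right_mono)
  qed
  obtain f where "bdd_functional 1 f" "\<And>w r. (w, r) \<in> span {(x, norm x)} \<Longrightarrow> f w = r"
    using hahn_banach[OF subspace_span _ bound] by auto
  moreover have "(x, norm x) \<in> span {(x, norm x)}"
    by (rule span_base) simp
  ultimately show ?thesis
    using that[of f] assms bdd_functional_bounded_linear by auto
qed

section \<open>Sequences equivalent to the basis of \<open>\<ell>\<^sub>1\<close>\<close>

text \<open>This is the lower half of equivalence to the unit vector basis; the upper half is a
  uniform bound on the norms of the \<open>x i\<close>, stated separately where it enters.\<close>

definition ell1_lower_bound :: "real \<Rightarrow> ('i \<Rightarrow> 'a::real_normed_vector) \<Rightarrow> bool" where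
  "ell1_lower_bound d x \<longleftrightarrow>
     (\<forall>I c. finite I \<longrightarrow> d * (\<Sum>i\<in>I. \<bar>c i\<bar>) \<le> norm (\<Sum>i\<in>I. c i *\<^sub>R x i))"

lemma ell1_lower_boundD:
  "ell1_lower_bound d x \<Longrightarrow> finite I \<Longrightarrow> d * (\<Sum>i\<in>I. \<bar>c i\<bar>) \<le> norm (\<Sum>i\<in>I. c i *\<^sub>R x i)"
  by (simp add: ell1_lower_bound_def)

text \<open>Coefficients are attached to indices rather than vectors, since \<open>g\<close> may
  repeat values. The definition of \<open>c'\<close> allows for the new index already occurring in
  \<open>I\<close>.\<close>

lemma span_range_explicit:
  assumes "v \<in> span (range g)"
  shows "\<exists>I c. finite I \<and> v = (\<Sum>i\<in>I. c i *\<^sub>R g i)"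
  using assms
proof (induction rule: span_induct_alt)
  case base
  show ?case by (rule exI[of _ "{}"]) simp
next
  case (step t u v)
  then obtain i I c where u: "u = g i" and I: "finite I" "v = (\<Sum>i\<in>I. c i *\<^sub>R g i)" by auto
  define c' where "c' j = (if j \<in> I then c j else 0) + (if j = i then t else 0)" for j
  have "(\<Sum>j\<in>insert i I. c' j *\<^sub>R g j) =
      (\<Sum>j\<in>insert i I. (if j \<in> I then c j else 0) *\<^sub>R g j) +
      (\<Sum>j\<in>insert i I. (if j = i then t else 0) *\<^sub>R g j)"
    by (simp add: c'_def scaleR_add_left sum.distrib)
  also have "(\<Sum>j\<in>insert i I. (if j = i then t else 0) *\<^sub>R g j) = t *\<^sub>R g i"
    using I(1) by (subst sum.remove[of _ i]) auto
  also have "(\<Sum>j\<in>insert i I. (if j \<in> I then c j else 0) *\<^sub>R g j) = v"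
    unfolding I(2) using I(1) by (intro sum.mono_neutral_cong_right) auto
  finally show ?case
    using I(1) u by (intro exI[of _ "insert i I"] exI[of _ c']) (simp add: add.commute)
qed

text \<open>On the graph spanned by the pairs \<open>(x i, s i)\<close> the second component is at
  most the sum of the \<open>\<bar>c i\<bar>\<close>, which the lower bound controls by
  \<open>norm w / d\<close>. The same estimate makes the graph single-valued.\<close>

lemma ell1_functional:
  fixes x :: "'i \<Rightarrow> 'a::real_normed_vector"
  assumes d: "d > 0" and x: "ell1_lower_bound d x" and s: "\<And>i. \<bar>s i\<bar> \<le> 1"
  obtains f where "bdd_functional (1 / d) f" "\<And>i. f (x i) = s i"
proof -
  define W where "W = span (range (\<lambda>i. (x i, s i)))"
  have bound: "r \<le> 1 / d * norm w" if wr: "(w, r) \<in> W" for w r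
  proof -
    obtain I c where I: "finite I" and "(w, r) = (\<Sum>i\<in>I. c i *\<^sub>R (x i, s i))"
      using span_range_explicit[OF wr[unfolded W_def]] by blast
    then have "w = fst (\<Sum>i\<in>I. c i *\<^sub>R (x i, s i))" "r = snd (\<Sum>i\<in>I. c i *\<^sub>R (x i, s i))"
      by (metis fst_conv, metis snd_conv)
    then have w: "w = (\<Sum>i\<in>I. c i *\<^sub>R x i)" and r: "r = (\<Sum>i\<in>I. c i * s i)"
      by (simp_all add: fst_sum snd_sum)
    have "r \<le> (\<Sum>i\<in>I. \<bar>c i\<bar>)"
      unfolding r
    proof (rule sum_mono)
      fix i
      have "c i * s i \<le> \<bar>c i\<bar> * \<bar>s i\<bar>"
        by (metis abs_ge_self abs_mult)
      also have "\<dots> \<le> \<bar>c i\<bar>"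
        using s[of i] by (simp add: mult_left_le)
      finally show "c i * s i \<le> \<bar>c i\<bar>" .
    qed
    also have "\<dots> \<le> 1 / d * norm w"
      using ell1_lower_boundD[OF x I, of c] d by (simp add: w field_simps)
    finally show ?thesis .
  qed
  obtain f where f: "bdd_functional (1 / d) f" "\<And>w r. (w, r) \<in> W \<Longrightarrow> f w = r"
    using hahn_banach[of W "1 / d"] bound d by (auto simp: W_def)
  have "f (x i) = s i" for i
    by (rule f(2)) (auto simp: W_def intro: span_base)
  with f(1) show ?thesis by (rule that; assumption)
qed

section \<open>The weak topology\<close>

lemma openin_weak_vimage:
  fixes f :: "'a::real_normed_vector \<Rightarrow> real"
  shows "bounded_linear f \<Longrightarrow> open U \<Longrightarrow> openin weak_topology (f -` U)"
  unfolding weak_topology_def by (intro topology_generated_by_Basis) blast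

lemma topspace_weak_topology [simp]: "topspace (weak_topology :: 'a::real_normed_vector topology) = UNIV"
proof -
  have "openin weak_topology ((\<lambda>x::'a. 0::real) -` UNIV)"
    by (rule openin_weak_vimage) (auto intro: bounded_linear_zero)
  then show ?thesis
    using openin_subset by fastforce
qed

lemma topspace_weak_unit_ball [simp]: "topspace weak_unit_ball = cball 0 1"
  by (simp add: weak_unit_ball_def)

lemma weak_neighbourhood:
  fixes a :: "'a::real_normed_vector"
  assumes "openin weak_topology U" "a \<in> U"
  obtains \<Phi> e where "finite \<Phi>" "\<And>f. f \<in> \<Phi> \<Longrightarrow> bounded_linear f" "e > (0::real)"
    "\<And>x. (\<And>f. f \<in> \<Phi> \<Longrightarrow> \<bar>f x - f a\<bar> < e) \<Longrightarrow> x \<in> U"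
proof -
  have "generate_topology_on {f -` U |(f :: 'a \<Rightarrow> real) U. bounded_linear f \<and> open U} U"
    using assms(1) by (simp add: weak_topology_def openin_topology_generated_by_iff)
  then have "\<exists>\<Phi> e. finite \<Phi> \<and> (\<forall>f\<in>\<Phi>. bounded_linear f) \<and> e > (0::real) \<and>
      (\<forall>x. (\<forall>f\<in>\<Phi>. \<bar>f x - f a\<bar> < e) \<longrightarrow> x \<in> U)"
    using assms(2)
  proof induction
    case Empty
    then show ?case by simp
  next
    case (Int S T)
    then have "a \<in> S" "a \<in> T" by auto
    obtain \<Phi> d where 1: "finite \<Phi>" "\<forall>f\<in>\<Phi>. bounded_linear f" "d > (0::real)"
      "\<forall>x. (\<forall>f\<in>\<Phi>. \<bar>f x - f a\<bar> < d) \<longrightarrow> x \<in> S"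
      using Int.IH(1)[OF \<open>a \<in> S\<close>] by blast
    obtain \<Psi> e where 2: "finite \<Psi>" "\<forall>f\<in>\<Psi>. bounded_linear f" "e > (0::real)"
      "\<forall>x. (\<forall>f\<in>\<Psi>. \<bar>f x - f a\<bar> < e) \<longrightarrow> x \<in> T"
      using Int.IH(2)[OF \<open>a \<in> T\<close>] by blast
    show ?case
      by (rule exI[of _ "\<Phi> \<union> \<Psi>"], rule exI[of _ "min d e"]) (use 1 2 in auto)
  next
    case (UN K)
    then obtain k where k: "k \<in> K" "a \<in> k" by blast
    obtain \<Phi> d where "finite \<Phi>" "\<forall>f\<in>\<Phi>. bounded_linear f" "d > (0::real)"
      "\<forall>x. (\<forall>f\<in>\<Phi>. \<bar>f x - f a\<bar> < d) \<longrightarrow> x \<in> k"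
      using UN.IH[OF k] by blast
    then show ?case
      using k(1) by (intro exI[of _ \<Phi>] exI[of _ d]) auto
  next
    case (Basis S)
    then obtain f :: "'a \<Rightarrow> real" and T where f: "S = f -` T" "bounded_linear f" "open T"
      by blast
    then obtain e where "e > 0" "\<And>y. dist y (f a) < e \<Longrightarrow> y \<in> T"
      using Basis.prems unfolding open_dist by auto
    then show ?case
      using f by (intro exI[of _ "{f}"] exI[of _ e]) (auto simp: dist_real_def)
  qed
  then obtain \<Phi> e where "finite \<Phi>" "\<forall>f\<in>\<Phi>. bounded_linear f" "e > (0::real)"
      "\<forall>x. (\<forall>f\<in>\<Phi>. \<bar>f x - f a\<bar> < e) \<longrightarrow> x \<in> U"
    by blast
  then show ?thesis
    using that[of \<Phi> e] by simp
qed

lemma weak_unit_ball_neighbourhood: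
  assumes "openin weak_unit_ball U" "a \<in> U"
  obtains \<Phi> e where "finite \<Phi>" "\<And>f. f \<in> \<Phi> \<Longrightarrow> bounded_linear f" "e > (0::real)"
    "\<And>x. norm x \<le> 1 \<Longrightarrow> (\<And>f. f \<in> \<Phi> \<Longrightarrow> \<bar>f x - f a\<bar> < e) \<Longrightarrow> x \<in> U"
proof -
  obtain T where T: "openin weak_topology T" "U = T \<inter> cball 0 1"
    using assms(1) by (auto simp: weak_unit_ball_def openin_subtopology)
  with assms(2) have "a \<in> T" by simp
  obtain \<Phi> e where *: "finite \<Phi>" "\<And>f. f \<in> \<Phi> \<Longrightarrow> bounded_linear f" "e > (0::real)"
    "\<And>x. (\<And>f. f \<in> \<Phi> \<Longrightarrow> \<bar>f x - f a\<bar> < e) \<Longrightarrow> x \<in> T"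
    using weak_neighbourhood[OF T(1) \<open>a \<in> T\<close>] by metis
  show ?thesis
    using *(1-3) by (rule that) (use *(4) T(2) in auto)
qed

lemma openin_weak_unit_ball_vimage:
  fixes f :: "'a::real_normed_vector \<Rightarrow> real"
  shows "bounded_linear f \<Longrightarrow> open U \<Longrightarrow> openin weak_unit_ball (f -` U \<inter> cball 0 1)"
  unfolding weak_unit_ball_def openin_subtopology using openin_weak_vimage by blast

lemma limitin_weak_unit_ball:
  fixes s :: "'i \<Rightarrow> 'a::real_normed_vector"
  assumes "norm a \<le> 1" "\<And>i. norm (s i) \<le> 1"
    and lim: "\<And>f::'a \<Rightarrow> real. bounded_linear f \<Longrightarrow> ((\<lambda>i. f (s i)) \<longlongrightarrow> f a) F"
  shows "limitin weak_unit_ball s a F"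
  unfolding limitin_def
proof (intro conjI allI impI)
  show "a \<in> topspace weak_unit_ball" using assms(1) by simp
  fix U assume "openin weak_unit_ball U \<and> a \<in> U"
  then obtain \<Phi> e where *: "finite \<Phi>" "\<And>f. f \<in> \<Phi> \<Longrightarrow> bounded_linear f" "e > (0::real)"
    "\<And>x. norm x \<le> 1 \<Longrightarrow> (\<And>f. f \<in> \<Phi> \<Longrightarrow> \<bar>f x - f a\<bar> < e) \<Longrightarrow> x \<in> U"
    using weak_unit_ball_neighbourhood by metis
  have "eventually (\<lambda>i. \<forall>f\<in>\<Phi>. \<bar>f (s i) - f a\<bar> < e) F"
    using *(1-3) tendstoD[OF lim]
    by (intro eventually_ball_finite) (auto simp: dist_real_def)
  then show "eventually (\<lambda>i. s i \<in> U) F"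
    by eventually_elim (use * assms(2) in auto)
qed

lemma weak_unit_ball_closure:
  fixes a :: "'a::real_normed_vector"
  assumes "a \<in> weak_unit_ball closure_of A" "finite \<Phi>" "e > (0::real)"
    "\<And>f. f \<in> \<Phi> \<Longrightarrow> bounded_linear f"
  obtains x where "x \<in> A" "\<And>f. f \<in> \<Phi> \<Longrightarrow> \<bar>f x - f a\<bar> < e"
proof -
  have a: "norm a \<le> 1"
    using assms(1) by (auto simp: in_closure_of)
  have "openin weak_unit_ball (cball 0 1 \<inter> (\<Inter>f\<in>\<Phi>. f -` ball (f a) e))"
    using assms(2,4)
  proof (induction \<Phi>)
    case empty
    then show ?case
      using openin_topspace[of weak_unit_ball] by simp
  next
    case (insert f \<Phi>)
    have "openin weak_unit_ball ((f -` ball (f a) e \<inter> cball 0 1) \<inter>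
        (cball 0 1 \<inter> (\<Inter>f\<in>\<Phi>. f -` ball (f a) e)))"
      using insert.prems insert.IH
      by (intro openin_Int[OF openin_weak_unit_ball_vimage]) auto
    then show ?case
      by (rule back_subst[of "openin _"]) auto
  qed
  moreover have "a \<in> cball 0 1 \<inter> (\<Inter>f\<in>\<Phi>. f -` ball (f a) e)"
    using assms(3) a by simp
  ultimately obtain x where "x \<in> A" "x \<in> (\<Inter>f\<in>\<Phi>. f -` ball (f a) e)"
    using assms(1) unfolding in_closure_of by blast
  then show ?thesis
    using that[of x] by (auto simp: dist_real_def abs_minus_commute)
qed

text \<open>If no point of \<open>K\<close> were the limit, each would have a subbasic neighbourhood
  outside the ultrafilter; finitely many of them cover \<open>K\<close>, and an ultrafilter cannot
  avoid all of these. This takes the place of extracting convergent subsequences from weakly compact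
  sets.\<close>

lemma weakly_compact_ultralimit:
  fixes y :: "'i \<Rightarrow> 'a::real_normed_vector"
  assumes V: "ultra V" and K: "compactin weak_unit_ball K" "\<And>i. y i \<in> K"
  shows "\<exists>l\<in>K. \<forall>f::'a \<Rightarrow> real. bounded_linear f \<longrightarrow> ((\<lambda>i. f (y i)) \<longlongrightarrow> f l) V"
proof (rule ccontr)
  assume "\<not> ?thesis"
  then have "\<forall>l\<in>K. \<exists>f::'a \<Rightarrow> real. \<exists>S. bounded_linear f \<and> open S \<and> f l \<in> S \<and>
      \<not> eventually (\<lambda>i. f (y i) \<in> S) V"
    unfolding tendsto_def by blast
  then obtain f :: "'a \<Rightarrow> 'a \<Rightarrow> real" and S where fS: "\<And>l. l \<in> K \<Longrightarrow> bounded_linear (f l) \<and> open (S l) \<and>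
      f l l \<in> S l \<and> \<not> eventually (\<lambda>i. f l (y i) \<in> S l) V"
    by metis
  have KB: "K \<subseteq> cball 0 1"
    using compactin_subset_topspace[OF K(1)] by simp
  let ?\<U> = "(\<lambda>l. f l -` S l \<inter> cball 0 1) ` K"
  have "\<exists>\<F>. finite \<F> \<and> \<F> \<subseteq> ?\<U> \<and> K \<subseteq> \<Union>\<F>"
  proof (rule compactinD[OF K(1)])
    fix U assume "U \<in> ?\<U>"
    then obtain l where "l \<in> K" "U = f l -` S l \<inter> cball 0 1" by auto
    then show "openin weak_unit_ball U"
      using fS[of l] by (simp add: openin_weak_unit_ball_vimage)
  next
    show "K \<subseteq> \<Union>?\<U>"
    proof
      fix l assume "l \<in> K"
      then have "l \<in> f l -` S l \<inter> cball 0 1" using fS KB by auto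
      with \<open>l \<in> K\<close> show "l \<in> \<Union>?\<U>" by blast
    qed
  qed
  then obtain \<F> where \<F>: "finite \<F>" "\<F> \<subseteq> ?\<U>" "K \<subseteq> \<Union>\<F>"
    by (elim exE conjE)
  obtain D where D: "D \<subseteq> K" "finite D" and "\<F> = (\<lambda>l. f l -` S l \<inter> cball 0 1) ` D"
    using finite_subset_image[OF \<F>(1,2)] by (elim exE conjE)
  with \<F>(3) have cover: "\<exists>l\<in>D. f l x \<in> S l" if "x \<in> K" for x
    using that by auto
  have "eventually (\<lambda>i. \<forall>l\<in>D. f l (y i) \<notin> S l) V"
    using D fS ultra_not_eventually[OF V] by (auto intro!: eventually_ball_finite)
  then have "eventually (\<lambda>i. False) V"
  proof eventually_elim
    case (elim i)
    then show False using cover[OF K(2)[of i]] by auto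
  qed
  then show False
    using V by (simp add: ultra_def)
qed

section \<open>Rosenthal's dichotomy along an ultrafilter\<close>

text \<open>The common skeleton of the selections below: the next index comes from a set of
  \<open>V\<close> that may depend on the finite set \<open>N\<close> of earlier ones.
  \<open>Q\<close> is an invariant of the chosen set, \<open>R\<close> relates a new index to its
  predecessors, and \<open>V \<le> sequentially\<close> makes the choice increasing.\<close>

lemma ultra_thread:
  fixes V :: "nat filter"
  assumes V: "V \<noteq> bot" "V \<le> sequentially"
    and base: "Q {}"
    and step: "\<And>N. finite N \<Longrightarrow> Q N \<Longrightarrow> eventually (\<lambda>n. Q (insert n N) \<and> R N n) V"
  obtains r :: "nat \<Rightarrow> nat" where "strict_mono r" "\<And>k. Q (r ` {..<k})" "\<And>k. R (r ` {..<k}) (r k)"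
proof -
  \<comment> \<open>The clause for \<open>k = 0\<close> pins the start to the empty set; dependent
    choice would otherwise admit any finite set satisfying \<open>Q\<close>.\<close>
  have "\<exists>F. \<forall>k. (finite (F k) \<and> Q (F k) \<and> (k = 0 \<longrightarrow> F k = {})) \<and>
     (\<exists>n. F (Suc k) = insert n (F k) \<and> (\<forall>m\<in>F k. m < n) \<and> R (F k) n)"
  proof (rule dependent_nat_choice)
    show "\<exists>N. finite N \<and> Q N \<and> (0 = (0::nat) \<longrightarrow> N = {})"
      using base by auto
    fix N and k :: nat assume N: "finite N \<and> Q N \<and> (k = 0 \<longrightarrow> N = {})"
    have "eventually (\<lambda>n. \<forall>m\<in>N. m < n) V"
      using N V(2) by (intro eventually_ball_finite ballI filter_leD[OF V(2)]) (auto simp: eventually_gt_at_top)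
    moreover have "eventually (\<lambda>n. Q (insert n N) \<and> R N n) V"
      using N by (intro step) auto
    ultimately have "eventually (\<lambda>n. (\<forall>m\<in>N. m < n) \<and> Q (insert n N) \<and> R N n) V"
      by eventually_elim auto
    then obtain n where "\<forall>m\<in>N. m < n" "Q (insert n N)" "R N n"
      using V(1) eventually_happens' by blast
    then show "\<exists>M. (finite M \<and> Q M \<and> (Suc k = 0 \<longrightarrow> M = {})) \<and>
        (\<exists>n. M = insert n N \<and> (\<forall>m\<in>N. m < n) \<and> R N n)"
      using N by (intro exI[of _ "insert n N"]) auto
  qed
  then obtain F r where F: "\<And>k. Q (F k)" "F 0 = {}" "\<And>k. F (Suc k) = insert (r k) (F k)"
      "\<And>k m. m \<in> F k \<Longrightarrow> m < r k" "\<And>k. R (F k) (r k)"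
    by metis
  have Fr: "F k = r ` {..<k}" for k
    by (induction k) (auto simp: F(2,3) lessThan_Suc)
  have "strict_mono r"
    unfolding strict_mono_Suc_iff using F(3,4) by auto
  then show ?thesis
    using F that[of r] by (simp add: Fr)
qed

text \<open>A set \<open>Z\<close> of functionals is good if the largeness of a functional of \<open>Z\<close> on infinitely many
  terms is excluded by prescribing, for each chosen index, a set of the ultrafilter in which all
  later indices are to be taken. Good sets form a \<open>\<sigma>\<close>-ideal, and Rosenthal's subsequence
  argument is run with the bad sets instead of the infinite ones.\<close>

definition good :: "nat filter \<Rightarrow> real \<Rightarrow> (nat \<Rightarrow> 'a) \<Rightarrow> ('a \<Rightarrow> real) set \<Rightarrow> bool" where
  "good V e x Z \<longleftrightarrow> (\<exists>S. (\<forall>i. eventually (S i) V) \<and>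
     (\<forall>w\<in>Z. \<forall>H. infinite H \<longrightarrow> (\<forall>i\<in>H. \<forall>j\<in>H. i < j \<longrightarrow> S i j) \<longrightarrow> (\<exists>n\<in>H. w (x n) < e)))"

lemma good_empty: "good V e x {}"
  unfolding good_def by (rule exI[of _ "\<lambda>_ _. True"]) simp

text \<open>A diagonal argument gives countable additivity of the ideal: the witnesses of all good
  \<open>Y n\<close> are merged so that the one of \<open>Y n\<close> binds only from index
  \<open>n\<close> on. A \<open>w\<close> staying large on an admissible \<open>H\<close> lies in
  some good \<open>Y n\<close>, and the part of \<open>H\<close> beyond \<open>n\<close> contradicts
  the witness of \<open>Y n\<close>.\<close>

lemma good_sieve:
  assumes ev: "eventually (\<lambda>n. good V e x (Y n)) V"
    and cover: "\<And>w H. w \<in> Z \<Longrightarrow> infinite H \<Longrightarrow> (\<forall>n\<in>H. w (x n) \<ge> e) \<Longrightarrow>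
      (\<forall>i\<in>H. \<forall>j\<in>H. i < j \<longrightarrow> good V e x (Y j)) \<Longrightarrow> \<exists>n. good V e x (Y n) \<and> w \<in> Y n"
  shows "good V e x Z"
proof -
  define G where "G n \<longleftrightarrow> good V e x (Y n)" for n
  have "\<forall>n. \<exists>S. G n \<longrightarrow> (\<forall>i. eventually (S i) V) \<and>
     (\<forall>w\<in>Y n. \<forall>H. infinite H \<longrightarrow> (\<forall>i\<in>H. \<forall>j\<in>H. i < j \<longrightarrow> S i j) \<longrightarrow> (\<exists>n\<in>H. w (x n) < e))"
    unfolding G_def good_def by auto
  then obtain S where S: "\<And>n i. G n \<Longrightarrow> eventually (S n i) V"
    "\<And>n w H. G n \<Longrightarrow> w \<in> Y n \<Longrightarrow> infinite H \<Longrightarrow> (\<forall>i\<in>H. \<forall>j\<in>H. i < j \<longrightarrow> S n i j) \<Longrightarrow> (\<exists>n\<in>H. w (x n) < e)"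
    by metis
  \<comment> \<open>Only finitely many \<open>n\<close> enter for each \<open>i\<close>, so
    \<open>S' i\<close> remains an event of \<open>V\<close>. The conjunct \<open>G j\<close> makes
    every element of \<open>H\<close> but the least one good.\<close>
  define S' where "S' i j \<longleftrightarrow> G j \<and> (\<forall>n\<in>{n. n \<le> i \<and> G n}. S n i j)" for i j
  have "eventually (S' i) V" for i
    unfolding S'_def using ev S(1)
    by (intro eventually_conj eventually_ball_finite) (auto simp: G_def)
  moreover have "\<exists>n\<in>H. w (x n) < e"
    if w: "w \<in> Z" and H: "infinite H" "\<forall>i\<in>H. \<forall>j\<in>H. i < j \<longrightarrow> S' i j" for w H
  proof (rule ccontr)
    assume "\<not> ?thesis"
    then have large: "\<forall>n\<in>H. w (x n) \<ge> e" by (auto simp: not_less)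
    obtain n where n: "G n" "w \<in> Y n"
      using cover[OF w H(1) large] H(2) by (auto simp: S'_def G_def)
    have "infinite (H - {..<n})"
      using H(1) by (simp add: Diff_infinite_finite)
    moreover have "\<forall>i\<in>H - {..<n}. \<forall>j\<in>H - {..<n}. i < j \<longrightarrow> S n i j"
      using H(2) n(1) by (auto simp: S'_def)
    ultimately show False
      using S(2)[OF n, of "H - {..<n}"] large by (meson DiffD1 not_less)
  qed
  ultimately show ?thesis
    unfolding good_def by (intro exI[of _ S']) blast
qed

text \<open>A \<open>w\<close> that is large on an infinite \<open>H\<close> belongs to the
  restricted sets for all \<open>n\<close> in \<open>H\<close>. Were these good for almost all
  \<open>n\<close>, the sieve would make \<open>Z\<close> good.\<close>

lemma bad_above:
  assumes V: "ultra V" and bad: "\<not> good V e x Z"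
  shows "eventually (\<lambda>n. \<not> good V e x (Z \<inter> {w. w (x n) \<ge> e})) V"
proof (rule ccontr)
  assume "\<not> ?thesis"
  then have "eventually (\<lambda>n. good V e x (Z \<inter> {w. w (x n) \<ge> e})) V"
    using ultra_not_eventually[OF V] by force
  then have "good V e x Z"
  proof (rule good_sieve)
    fix w H assume *: "w \<in> Z" "infinite H" "\<forall>n\<in>H. w (x n) \<ge> e"
      "\<forall>i\<in>H. \<forall>j\<in>H. i < j \<longrightarrow> good V e x (Z \<inter> {w. w (x j) \<ge> e})"
    \<comment> \<open>Goodness is known only at indices with a predecessor in \<open>H\<close>, so
      an index above \<open>i\<close> is used.\<close>
    obtain i where i: "i \<in> H" using *(2) by fastforce
    obtain j where "j \<in> H" "i < j" using *(2) by (meson infinite_nat_iff_unbounded)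
    with i * show "\<exists>n. good V e x (Z \<inter> {w. w (x n) \<ge> e}) \<and> w \<in> Z \<inter> {w. w (x n) \<ge> e}"
      by blast
  qed
  with bad show False by simp
qed

text \<open>Here the limit along \<open>V\<close> does the covering: each \<open>w\<close> is below
  \<open>e / 2\<close> at almost all \<open>n\<close>, in particular at one whose restricted set is
  good.\<close>

lemma bad_below:
  assumes V: "ultra V" and bad: "\<not> good V e x Z" and e: "e > 0"
    and lim: "\<And>w. w \<in> Z \<Longrightarrow> ((\<lambda>n. w (x n)) \<longlongrightarrow> 0) V"
  shows "eventually (\<lambda>n. \<not> good V e x (Z \<inter> {w. w (x n) \<le> e / 2})) V"
proof (rule ccontr)
  assume "\<not> ?thesis"
  then have ev: "eventually (\<lambda>n. good V e x (Z \<inter> {w. w (x n) \<le> e / 2})) V"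
    using ultra_not_eventually[OF V] by force
  then have "good V e x Z"
  proof (rule good_sieve)
    fix w assume w: "w \<in> Z"
    have "eventually (\<lambda>n. w (x n) < e / 2) V"
      using order_tendstoD(2)[OF lim[OF w], of "e / 2"] e by simp
    with ev have "eventually (\<lambda>n. good V e x (Z \<inter> {w. w (x n) \<le> e / 2}) \<and> w (x n) < e / 2) V"
      by (rule eventually_conj)
    then obtain n where "good V e x (Z \<inter> {w. w (x n) \<le> e / 2})" "w (x n) < e / 2"
      using eventually_happens'[OF ultra_nonbot[OF V]] by blast
    then show "\<exists>n. good V e x (Z \<inter> {w. w (x n) \<le> e / 2}) \<and> w \<in> Z \<inter> {w. w (x n) \<le> e / 2}"
      using w by (intro exI[of _ n]) simp
  qed
  with bad show False by simp
qed

text \<open>The invariant is that all cells of the chosen indices are bad: at almost every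
  \<open>n\<close> each of the finitely many bad cells has a bad upper and a bad lower part. Bad
  sets are nonempty, and this is the Boolean independence.\<close>

lemma bad_independent_subsequence:
  fixes x :: "nat \<Rightarrow> 'a"
  assumes V: "ultra V" "V \<le> sequentially" and e: "e > 0"
    and bad: "\<not> good V e x D"
    and lim: "\<And>w. w \<in> D \<Longrightarrow> ((\<lambda>n. w (x n)) \<longlongrightarrow> 0) V"
  obtains r :: "nat \<Rightarrow> nat" where "strict_mono r"
    "\<And>k P. P \<subseteq> {..<k} \<Longrightarrow> \<exists>w\<in>D. (\<forall>i\<in>P. w (x (r i)) \<ge> e) \<and> (\<forall>i\<in>{..<k} - P. w (x (r i)) \<le> e / 2)"
proof -
  define cell where "cell N P = {w\<in>D. (\<forall>n\<in>P. w (x n) \<ge> e) \<and> (\<forall>n\<in>N - P. w (x n) \<le> e / 2)}" for N P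
  define Q where "Q N \<longleftrightarrow> (\<forall>P\<in>Pow N. \<not> good V e x (cell N P))" for N
  have step: "eventually (\<lambda>n. Q (insert n N) \<and> True) V" if N: "finite N" "Q N" for N
  proof -
    have "eventually (\<lambda>n. \<forall>P\<in>Pow N. \<not> good V e x (cell N P \<inter> {w. w (x n) \<ge> e})) V"
      using N by (intro eventually_ball_finite ballI bad_above[OF V(1)]) (auto simp: Q_def)
    moreover have "eventually (\<lambda>n. \<forall>P\<in>Pow N. \<not> good V e x (cell N P \<inter> {w. w (x n) \<le> e / 2})) V"
      using N by (intro eventually_ball_finite ballI bad_below[OF V(1) _ e lim]) (auto simp: Q_def cell_def)
    moreover have "eventually (\<lambda>n. \<forall>m\<in>N. m < n) V"
      using N V(2) by (intro eventually_ball_finite ballI filter_leD[OF V(2)]) (auto simp: eventually_gt_at_top)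
    ultimately show ?thesis
    proof eventually_elim
      case (elim n)
      then have n: "n \<notin> N" by blast
      have "\<not> good V e x (cell (insert n N) P)" if P: "P \<subseteq> insert n N" for P
      proof (cases "n \<in> P")
        case True
        have "cell (insert n N) P = cell N (P - {n}) \<inter> {w. w (x n) \<ge> e}"
          using True n by (auto simp: cell_def)
        then show ?thesis using elim(1) P by auto
      next
        case False
        have "cell (insert n N) P = cell N P \<inter> {w. w (x n) \<le> e / 2}"
          using False n by (auto simp: cell_def)
        then show ?thesis using elim(2) P False by auto
      qed
      then show ?case by (simp add: Q_def)
    qed
  qed
  have "Q {}" using bad by (simp add: Q_def cell_def)
  then obtain r :: "nat \<Rightarrow> nat" where r: "strict_mono r" "\<And>k. Q (r ` {..<k})"
    using ultra_thread[OF ultra_nonbot[OF V(1)] V(2), of Q "\<lambda>_ _. True"] step by metis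
  have inj: "inj r" using r(1) by (rule strict_mono_imp_inj_on)
  show ?thesis
  proof (rule that[OF r(1)])
    fix k and P :: "nat set" assume P: "P \<subseteq> {..<k}"
    then have "\<not> good V e x (cell (r ` {..<k}) (r ` P))"
      using r(2)[of k] by (auto simp: Q_def)
    then obtain w where "w \<in> cell (r ` {..<k}) (r ` P)"
      using good_empty by (metis ex_in_conv)
    then show "\<exists>w\<in>D. (\<forall>i\<in>P. w (x (r i)) \<ge> e) \<and> (\<forall>i\<in>{..<k} - P. w (x (r i)) \<le> e / 2)"
      using P by (auto simp: cell_def image_set_diff[OF inj, symmetric])
  qed
qed

text \<open>Take \<open>v\<close> high where the coefficients are positive and low at the other
  terms, and \<open>w\<close> the other way round. Then \<open>v - w\<close> has the sign of each
  nonzero coefficient and size at least \<open>e / 2\<close>, while its norm is at most 2; hence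
  \<open>e / 4\<close>.\<close>

lemma ell1_lower_bound_independent:
  fixes x :: "nat \<Rightarrow> 'a::real_normed_vector"
  assumes ind: "\<And>k P. P \<subseteq> {..<k} \<Longrightarrow> \<exists>w. bdd_functional 1 w \<and>
    (\<forall>i\<in>P. w (x i) \<ge> e) \<and> (\<forall>i\<in>{..<k} - P. w (x i) \<le> e / 2)"
  shows "ell1_lower_bound (e / 4) x"
  unfolding ell1_lower_bound_def
proof (intro allI impI)
  fix I :: "nat set" and c :: "nat \<Rightarrow> real" assume "finite I"
  then obtain k where k: "I \<subseteq> {..<k}"
    using finite_nat_iff_bounded by blast
  let ?P = "{i\<in>I. c i > 0}" and ?Q = "{i\<in>I. c i \<le> 0}"
  obtain v where v: "bdd_functional 1 v" "\<forall>i\<in>?P. v (x i) \<ge> e" "\<forall>i\<in>{..<k} - ?P. v (x i) \<le> e / 2"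
    using ind[of ?P k] k by blast
  obtain w where w: "bdd_functional 1 w" "\<forall>i\<in>?Q. w (x i) \<ge> e" "\<forall>i\<in>{..<k} - ?Q. w (x i) \<le> e / 2"
    using ind[of ?Q k] k by blast
  let ?s = "\<Sum>i\<in>I. c i *\<^sub>R x i"
  have "(e / 2) * (\<Sum>i\<in>I. \<bar>c i\<bar>) = (\<Sum>i\<in>I. \<bar>c i\<bar> * (e / 2))"
    by (simp add: sum_distrib_left mult.commute)
  also have "\<dots> \<le> (\<Sum>i\<in>I. c i * (v (x i) - w (x i)))"
  proof (rule sum_mono)
    fix i assume i: "i \<in> I"
    show "\<bar>c i\<bar> * (e / 2) \<le> c i * (v (x i) - w (x i))"
    proof (cases "c i > 0")
      case True
      then have "v (x i) \<ge> e" "w (x i) \<le> e / 2" using v w i k by auto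
      then have "e / 2 \<le> v (x i) - w (x i)" by simp
      then show ?thesis using True by simp
    next
      case False
      then have "w (x i) \<ge> e" "v (x i) \<le> e / 2" using v w i k by auto
      then have "e / 2 \<le> w (x i) - v (x i)" by simp
      then have "(- c i) * (e / 2) \<le> (- c i) * (w (x i) - v (x i))"
        using False by (intro mult_left_mono) auto
      then show ?thesis using False by (simp add: algebra_simps)
    qed
  qed
  also have "\<dots> = v ?s - w ?s"
    using bdd_functional_linear[OF v(1)] bdd_functional_linear[OF w(1)]
    by (simp add: linear_sum linear_scale right_diff_distrib sum_subtractf)
  also have "\<dots> \<le> 2 * norm ?s"
    using bdd_functional_abs_le[OF v(1), of ?s] bdd_functional_abs_le[OF w(1), of ?s] by linarith
  finally show "e / 4 * (\<Sum>i\<in>I. \<bar>c i\<bar>) \<le> norm ?s" by simp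
qed

text \<open>One subsequence obeys the witnesses for all levels \<open>1 / (k + 1)\<close>, each from
  some index on. A functional of norm at most 1 that exceeded such a level infinitely often would
  then contradict the witness of that level.\<close>

lemma good_weakly_null_subsequence:
  fixes x :: "nat \<Rightarrow> 'a::real_normed_vector"
  assumes V: "ultra V" "V \<le> sequentially"
    and good: "\<And>e. e > 0 \<Longrightarrow> good V e x {w. bdd_functional 1 w}"
  obtains r :: "nat \<Rightarrow> nat" where "strict_mono r"
    "\<And>f. bounded_linear f \<Longrightarrow> (\<lambda>n. f (x (r n)) :: real) \<longlonglongrightarrow> 0"
proof -
  have "\<forall>k. \<exists>S. (\<forall>i. eventually (S i) V) \<and>
     (\<forall>w\<in>{w. bdd_functional 1 w}. \<forall>H. infinite H \<longrightarrow> (\<forall>i\<in>H. \<forall>j\<in>H. i < j \<longrightarrow> S i j) \<longrightarrow>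
       (\<exists>n\<in>H. w (x n) < inverse (real (Suc k))))"
    using good unfolding good_def by simp
  then obtain S where S: "\<And>k i. eventually (S k i) V"
    "\<And>k w H. bdd_functional 1 w \<Longrightarrow> infinite H \<Longrightarrow> (\<forall>i\<in>H. \<forall>j\<in>H. i < j \<longrightarrow> S k i j) \<Longrightarrow>
       (\<exists>n\<in>H. w (x n) < inverse (real (Suc k)))"
    by (metis mem_Collect_eq)
  \<comment> \<open>\<open>card N\<close> counts the terms already chosen, so the choice of
    \<open>r j\<close> respects the witnesses \<open>S k\<close> with
    \<open>k \<le> j\<close>.\<close>
  have step: "eventually (\<lambda>n. True \<and> (\<forall>i\<in>N. \<forall>k\<in>{..card N}. S k i n)) V" if "finite N" for N
    using that S(1) by (intro eventually_conj eventually_ball_finite ballI) auto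
  have "\<exists>r :: nat \<Rightarrow> nat. strict_mono r \<and>
      (\<forall>j. \<forall>i\<in>r ` {..<j}. \<forall>k\<in>{..card (r ` {..<j})}. S k i (r j))"
  proof (rule ultra_thread[OF ultra_nonbot[OF V(1)] V(2)])
    fix r :: "nat \<Rightarrow> nat"
    assume "strict_mono r"
      "\<And>j. \<forall>i\<in>r ` {..<j}. \<forall>k\<in>{..card (r ` {..<j})}. S k i (r j)"
    then show ?thesis by blast
  qed (rule TrueI, rule step)
  then obtain r :: "nat \<Rightarrow> nat" where r: "strict_mono r"
      and R: "\<And>j. \<forall>i\<in>r ` {..<j}. \<forall>k\<in>{..card (r ` {..<j})}. S k i (r j)"
    by blast
  have inj: "inj r" using r by (rule strict_mono_imp_inj_on)
  have "card (r ` {..<j}) = j" for j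
    by (simp add: card_image inj_on_subset[OF inj])
  with R have R: "S k (r i) (r j)" if "i < j" "k \<le> j" for i j k
    using that by auto
  have up: "eventually (\<lambda>n. w (x (r n)) < e) sequentially" if w: "bdd_functional 1 w" and e: "e > 0" for w e
  proof (rule ccontr)
    assume "\<not> ?thesis"
    then have inf: "infinite {n. w (x (r n)) \<ge> e}"
      by (simp add: eventually_cofinite not_less flip: cofinite_eq_sequentially)
    obtain k where k: "inverse (real (Suc k)) < e"
      using reals_Archimedean[OF e] by blast
    \<comment> \<open>The witness \<open>S k\<close> is respected by pairs whose later index is at
      least \<open>k\<close>, so the indices below \<open>k\<close> are discarded.\<close>
    define J where "J = {n. w (x (r n)) \<ge> e} - {..<k}"
    have "infinite (r ` J)"
      using inf by (simp add: J_def Diff_infinite_finite finite_image_iff inj_on_subset[OF inj])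
    moreover have "\<forall>i\<in>r ` J. \<forall>j\<in>r ` J. i < j \<longrightarrow> S k i j"
      using R strict_mono_less[OF r] by (auto simp: J_def)
    ultimately obtain n where "n \<in> r ` J" "w (x n) < inverse (real (Suc k))"
      using S(2)[OF w] by blast
    with k show False by (auto simp: J_def)
  qed
  have lim: "(\<lambda>n. w (x (r n))) \<longlonglongrightarrow> 0" if w: "bdd_functional 1 w" for w
  proof (rule order_tendstoI)
    fix a :: real assume "a < 0"
    then have "eventually (\<lambda>n. - w (x (r n)) < - a) sequentially"
      using up[OF bdd_functional_minus[OF w], of "- a"] by simp
    then show "eventually (\<lambda>n. a < w (x (r n))) sequentially" by simp
  qed (use up[OF w] in simp)
  show ?thesis
  proof (rule that[OF r])
    fix f :: "'a \<Rightarrow> real" assume "bounded_linear f"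
    then obtain C where C: "C > 0" "bdd_functional C f"
      by (rule bounded_linear_bdd_functional)
    then have "bdd_functional 1 (\<lambda>x. inverse C * f x)"
      using bdd_functional_scale[OF C(2), of "inverse C"] by simp
    then have "(\<lambda>n. C * (inverse C * f (x (r n)))) \<longlonglongrightarrow> C * 0"
      by (intro tendsto_mult lim tendsto_const)
    then show "(\<lambda>n. f (x (r n))) \<longlonglongrightarrow> 0"
      using C(1) by simp
  qed
qed

text \<open>The alternative is whether the dual unit ball is good at every level. A single bad level
  \<open>e\<close> already gives independence at the heights \<open>e\<close> and
  \<open>e / 2\<close>.\<close>

theorem weakly_null_or_ell1_subsequence:
  fixes x :: "nat \<Rightarrow> 'a::real_normed_vector"
  assumes V: "ultra V" "V \<le> sequentially"
    and lim: "\<And>f. bounded_linear f \<Longrightarrow> ((\<lambda>n. f (x n) :: real) \<longlongrightarrow> 0) V"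
  obtains (null) r :: "nat \<Rightarrow> nat" where "strict_mono r"
      "\<And>f. bounded_linear f \<Longrightarrow> (\<lambda>n. f (x (r n)) :: real) \<longlonglongrightarrow> 0"
    | (ell1) r :: "nat \<Rightarrow> nat" and d where "strict_mono r" "d > 0" "ell1_lower_bound d (\<lambda>n. x (r n))"
proof (cases "\<forall>e>0. good V e x {w. bdd_functional 1 w}")
  case True
  then show ?thesis
    using good_weakly_null_subsequence[OF V, of x] null by blast
next
  case False
  then obtain e where e: "e > 0" "\<not> good V e x {w. bdd_functional 1 w}" by blast
  then obtain r :: "nat \<Rightarrow> nat" where r: "strict_mono r"
    "\<And>k P. P \<subseteq> {..<k} \<Longrightarrow> \<exists>w\<in>{w. bdd_functional 1 w}. (\<forall>i\<in>P. w (x (r i)) \<ge> e) \<and>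
      (\<forall>i\<in>{..<k} - P. w (x (r i)) \<le> e / 2)"
    using bad_independent_subsequence[OF V e] lim bdd_functional_bounded_linear
    by blast
  have "ell1_lower_bound (e / 4) (\<lambda>n. x (r n))"
    by (rule ell1_lower_bound_independent) (use r(2) in blast)
  with r(1) e(1) show ?thesis
    by (intro ell1[of r "e / 4"]) auto
qed

section \<open>Countable tightness and the Frechet--Urysohn property\<close>

text \<open>The compactness half of Kaplansky's tightness theorem. If every finite \<open>E\<close>
  were defeated by an \<open>m\<close>-tuple of functionals, take the ultralimit of these tuples
  along the finite subsets of \<open>A\<close>. Some \<open>x\<close> in \<open>A\<close> is close
  to \<open>a\<close> on the limit tuple, hence on the tuples of almost all \<open>E\<close>, and
  almost all \<open>E\<close> contain \<open>x\<close>.\<close>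

lemma weak_closure_finite_witness:
  fixes a :: "'a::real_normed_vector"
  assumes a: "a \<in> weak_unit_ball closure_of A"
  obtains E where "finite E" "E \<subseteq> A"
    "\<And>f. (\<And>i. bdd_functional 1 (f i)) \<Longrightarrow> \<exists>x\<in>E. \<forall>i<m. \<bar>f i x - f i a\<bar> < inverse (real (Suc m))"
proof (rule ccontr)
  let ?e = "inverse (real (Suc m))"
  assume "\<not> thesis"
  then have "\<forall>E. \<exists>f. finite E \<and> E \<subseteq> A \<longrightarrow>
      (\<forall>i. bdd_functional 1 (f i)) \<and> (\<forall>x\<in>E. \<exists>i<m. \<bar>f i x - f i a\<bar> \<ge> ?e)"
    using that by (metis not_less)
  then obtain f0 where f0: "\<And>E. finite E \<Longrightarrow> E \<subseteq> A \<Longrightarrow> \<forall>i. bdd_functional 1 (f0 E i)"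
      "\<And>E. finite E \<Longrightarrow> E \<subseteq> A \<Longrightarrow> \<forall>x\<in>E. \<exists>i<m. \<bar>f0 E i x - f0 E i a\<bar> \<ge> ?e"
    by metis
  \<comment> \<open>Zero functionals as default values keep the whole family in the dual ball, as
    the ultralimit requires.\<close>
  define f where "f E = (if finite E \<and> E \<subseteq> A then f0 E else (\<lambda>_ _. 0))" for E
  have f: "bdd_functional 1 (f E i)" for E i
    using f0(1) by (auto simp: f_def bdd_functional_def linear_iff)
  obtain V where V: "ultra V" "V \<le> finite_subsets_at_top A"
    using ultra_exists[OF finite_subsets_at_top_neq_bot[of A]] by metis
  have "\<exists>g. bdd_functional 1 g \<and> (\<forall>x. ((\<lambda>E. f E i x) \<longlongrightarrow> g x) V)" for i
    using bdd_functional_ultralimit[OF V(1), of 1 "\<lambda>E. f E i"] f by metis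
  then obtain g where g: "\<And>i. bdd_functional 1 (g i)" "\<And>i x. ((\<lambda>E. f E i x) \<longlongrightarrow> g i x) V"
    by metis
  obtain x where x: "x \<in> A" "\<And>h. h \<in> g ` {..<m} \<Longrightarrow> \<bar>h x - h a\<bar> < ?e"
    using weak_unit_ball_closure[OF a, of "g ` {..<m}" ?e] bdd_functional_bounded_linear[OF g(1)]
    by auto
  have "eventually (\<lambda>E. \<forall>i\<in>{..<m}. \<bar>f E i x - f E i a\<bar> < ?e) V"
  proof (intro eventually_ball_finite ballI)
    fix i assume "i \<in> {..<m}"
    have "((\<lambda>E. \<bar>f E i x - f E i a\<bar>) \<longlongrightarrow> \<bar>g i x - g i a\<bar>) V"
      by (intro tendsto_intros g)
    then show "eventually (\<lambda>E. \<bar>f E i x - f E i a\<bar> < ?e) V"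
      by (rule order_tendstoD) (use x(2) \<open>i \<in> {..<m}\<close> in auto)
  qed simp
  moreover have "eventually (\<lambda>E. finite E \<and> E \<subseteq> A \<and> x \<in> E) (finite_subsets_at_top A)"
    unfolding eventually_finite_subsets_at_top using x(1) by (intro exI[of _ "{x}"]) auto
  then have "eventually (\<lambda>E. finite E \<and> E \<subseteq> A \<and> x \<in> E) V"
    by (rule filter_leD[OF V(2)])
  ultimately have "eventually (\<lambda>E. False) V"
  proof eventually_elim
    case (elim E)
    then obtain i where "i < m" "\<bar>f0 E i x - f0 E i a\<bar> \<ge> ?e"
      using f0(2)[of E] by auto
    moreover have "\<bar>f0 E i x - f0 E i a\<bar> < ?e"
      using elim \<open>i < m\<close> by (auto simp: f_def)
    ultimately show False by linarith
  qed
  then show False using V(1) by (simp add: ultra_def)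
qed

text \<open>The union \<open>B\<close> of the finite witnesses is countable and approximates
  \<open>a\<close> on every finite set of functionals of the dual ball. An ultrafilter on an
  enumeration of \<open>B\<close> turns this into a limit for all functionals at once.\<close>

lemma weak_closure_sequence:
  fixes a :: "'a::real_normed_vector"
  assumes a: "a \<in> weak_unit_ball closure_of A"
  obtains s :: "nat \<Rightarrow> 'a" and V where "range s \<subseteq> A" "ultra V"
    "\<And>f. bounded_linear f \<Longrightarrow> ((\<lambda>n. f (s n) :: real) \<longlongrightarrow> f a) V"
proof -
  have "\<forall>m. \<exists>E. finite E \<and> E \<subseteq> A \<and> (\<forall>f. (\<forall>i. bdd_functional 1 (f i)) \<longrightarrow>
      (\<exists>x\<in>E. \<forall>i<m. \<bar>f i x - f i a\<bar> < inverse (real (Suc m))))"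
    using weak_closure_finite_witness[OF a] by metis
  then obtain E where E: "\<And>m. finite (E m)" "\<And>m. E m \<subseteq> A"
    "\<And>m f. (\<And>i. bdd_functional 1 (f i)) \<Longrightarrow> \<exists>x\<in>E m. \<forall>i<m. \<bar>f i x - f i a\<bar> < inverse (real (Suc m))"
    by metis
  define B where "B = (\<Union>m. E m)"
  have zero: "bdd_functional 1 (\<lambda>_. 0)"
    by (simp add: bdd_functional_def linear_iff)
  have "countable B" using E(1) by (simp add: B_def countable_finite)
  moreover have "B \<noteq> {}" using E(3)[of "\<lambda>_ _. 0" 0] zero by (auto simp: B_def)
  ultimately have range: "range (from_nat_into B) = B"
    by (simp add: range_from_nat_into)
  define s where "s = from_nat_into B"
  define D where "D = {w :: 'a \<Rightarrow> real. bdd_functional 1 w}"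
  have near: "\<exists>n. \<forall>w\<in>T. \<bar>w (s n) - w a\<bar> < inverse (real (Suc k))" if T: "finite T" "T \<subseteq> D" for T k
  proof -
    obtain h where h: "bij_betw h {0..<card T} T"
      using ex_bij_betw_nat_finite[OF T(1)] by blast
    \<comment> \<open>\<open>m\<close> must leave room for all functionals of \<open>T\<close> and
      give at least the precision of \<open>k\<close>; the tuple is padded with zeros.\<close>
    define m where "m = max k (card T)"
    define f where "f i = (if i < card T then h i else (\<lambda>_. 0))" for i
    have "bdd_functional 1 (f i)" for i
      using zero T(2) bij_betwE[OF h] by (auto simp: f_def D_def)
    then have "\<exists>x\<in>E m. \<forall>i<m. \<bar>f i x - f i a\<bar> < inverse (real (Suc m))"
      by (rule E(3))
    then obtain x where x: "x \<in> E m" "\<And>i. i < m \<Longrightarrow> \<bar>f i x - f i a\<bar> < inverse (real (Suc m))"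
      by blast
    have "x \<in> range s" using x(1) range by (auto simp: s_def B_def)
    then obtain n where n: "x = s n" by auto
    have "\<bar>w (s n) - w a\<bar> < inverse (real (Suc k))" if w: "w \<in> T" for w
    proof -
      obtain i where i: "i < card T" "w = h i"
        using bij_betw_imp_surj_on[OF h] w by fastforce
      then have "\<bar>w (s n) - w a\<bar> < inverse (real (Suc m))"
        using x(2)[of i] by (simp add: f_def n m_def)
      also have "\<dots> \<le> inverse (real (Suc k))"
        by (rule le_imp_inverse_le) (auto simp: m_def)
      finally show ?thesis .
    qed
    then show ?thesis by blast
  qed
  then have "\<forall>p. \<exists>n. finite (fst p) \<and> fst p \<subseteq> D \<longrightarrow>
      (\<forall>w\<in>fst p. \<bar>w (s n) - w a\<bar> < inverse (real (Suc (snd p))))"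
    by blast
  then obtain N where N: "\<And>p. finite (fst p) \<and> fst p \<subseteq> D \<Longrightarrow>
      (\<forall>w\<in>fst p. \<bar>w (s (N p)) - w a\<bar> < inverse (real (Suc (snd p))))"
    by metis
  \<comment> \<open>Finite sets of functionals paired with precisions form a directed set. The image
    of its tail filter under \<open>N\<close> lives on the indices of \<open>s\<close>, and along it
    \<open>w (s n)\<close> tends to \<open>w a\<close> for every \<open>w\<close> in
    \<open>D\<close>.\<close>
  define G where "G = filtermap N (finite_subsets_at_top D \<times>\<^sub>F sequentially)"
  have "G \<noteq> bot"
    by (simp add: G_def filtermap_bot_iff prod_filter_eq_bot)
  then obtain V where V: "V \<le> G" "ultra V"
    by (rule ultra_exists)
  have limD: "((\<lambda>n. w (s n)) \<longlongrightarrow> w a) V" if w: "w \<in> D" for w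
  proof (rule tendstoI)
    fix e :: real assume "e > 0"
    then obtain k where k: "inverse (real (Suc k)) < e"
      using reals_Archimedean by blast
    have "eventually (\<lambda>T. finite T \<and> T \<subseteq> D \<and> w \<in> T) (finite_subsets_at_top D)"
      unfolding eventually_finite_subsets_at_top using w by (intro exI[of _ "{w}"]) auto
    then have "eventually (\<lambda>p. (finite (fst p) \<and> fst p \<subseteq> D \<and> w \<in> fst p) \<and> k \<le> snd p)
        (finite_subsets_at_top D \<times>\<^sub>F sequentially)"
      by (rule eventually_prodI) (rule eventually_ge_at_top)
    then have "eventually (\<lambda>p. dist (w (s (N p))) (w a) < e) (finite_subsets_at_top D \<times>\<^sub>F sequentially)"
    proof eventually_elim
      case (elim p)
      then have "\<bar>w (s (N p)) - w a\<bar> < inverse (real (Suc (snd p)))"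
        using N by blast
      also have "\<dots> \<le> inverse (real (Suc k))"
        using elim by (intro le_imp_inverse_le) auto
      finally show ?case using k by (simp add: dist_real_def)
    qed
    then show "eventually (\<lambda>n. dist (w (s n)) (w a) < e) V"
      by (intro filter_leD[OF V(1)]) (simp add: G_def eventually_filtermap)
  qed
  show ?thesis
  proof (rule that[OF _ V(2)])
    show "range s \<subseteq> A" using range E(2) by (auto simp: s_def B_def)
    fix f :: "'a \<Rightarrow> real" assume "bounded_linear f"
    then obtain C where C: "C > 0" "bdd_functional C f"
      by (rule bounded_linear_bdd_functional)
    then have "(\<lambda>x. inverse C * f x) \<in> D"
      using bdd_functional_scale[OF C(2), of "inverse C"] by (simp add: D_def)
    then have "((\<lambda>n. C * (inverse C * f (s n))) \<longlongrightarrow> C * (inverse C * f a)) V"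
      by (intro tendsto_mult tendsto_const limD)
    then show "((\<lambda>n. f (s n)) \<longlongrightarrow> f a) V"
      using C(1) by simp
  qed
qed

lemma functional_separates:
  fixes x y :: "'a::real_normed_vector"
  assumes "x \<noteq> y"
  obtains f :: "'a \<Rightarrow> real" where "bounded_linear f" "f x \<noteq> f y"
proof -
  obtain f :: "'a \<Rightarrow> real" where f: "bounded_linear f" "f (x - y) \<noteq> 0"
    using functional_separates_0[of "x - y"] assms by auto
  then show ?thesis
    using that[of f] linear_diff[OF bounded_linear.linear[OF f(1)]] by auto
qed

text \<open>The bound 2 comes from the translates \<open>s n - a\<close> of ball points, to which
  the dichotomy is applied.\<close>

lemma frechet_urysohn_weak_unit_ball:
  assumes no_ell1: "\<And>(x :: nat \<Rightarrow> 'a::real_normed_vector) d.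
    (\<And>n. norm (x n) \<le> 2) \<Longrightarrow> d > 0 \<Longrightarrow> \<not> ell1_lower_bound d x"
  shows "frechet_urysohn_space (weak_unit_ball :: 'a topology)"
  unfolding frechet_urysohn_space_def
proof (intro allI impI)
  fix A and a :: 'a
  assume A: "A \<subseteq> topspace weak_unit_ball \<and> a \<in> weak_unit_ball closure_of A"
  then have nA: "norm x \<le> 1" if "x \<in> A" for x using that by auto
  have na: "norm a \<le> 1" using A by (auto simp: in_closure_of)
  obtain s :: "nat \<Rightarrow> 'a" and V where s: "range s \<subseteq> A" and V: "ultra V"
    and lim: "\<And>f. bounded_linear f \<Longrightarrow> ((\<lambda>n. f (s n) :: real) \<longlongrightarrow> f a) V"
    using weak_closure_sequence[of a A] A by blast
  show "\<exists>s. range s \<subseteq> A \<and> limitin weak_unit_ball s a sequentially"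
  proof (cases "a \<in> A")
    case True
    then show ?thesis
      using na by (intro exI[of _ "\<lambda>_. a"]) (auto intro!: limitin_weak_unit_ball)
  next
    case False
    \<comment> \<open>As \<open>a\<close> is outside \<open>A\<close>, a functional separates it
      from \<open>s i\<close>, so \<open>V\<close> does not concentrate on the index
      \<open>i\<close>. Thus \<open>V\<close> is free and subsequences can be selected along
      it.\<close>
    have ne: "eventually (\<lambda>n. n \<noteq> i) V" for i
    proof -
      have "s i \<noteq> a" using False s by auto
      then obtain f :: "'a \<Rightarrow> real" where f: "bounded_linear f" "f (s i) \<noteq> f a"
        by (rule functional_separates)
      have "eventually (\<lambda>n. f (s n) \<noteq> f (s i)) V"
        using f(2) by (intro tendsto_imp_eventually_ne[OF lim[OF f(1)]]) auto
      then show ?thesis by eventually_elim auto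
    qed
    have free: "V \<le> sequentially"
      unfolding cofinite_eq_sequentially[symmetric]
    proof (rule filter_leI)
      fix P :: "nat \<Rightarrow> bool" assume "eventually P cofinite"
      then have "eventually (\<lambda>n. \<forall>i\<in>{i. \<not> P i}. n \<noteq> i) V"
        using ne by (intro eventually_ball_finite) (auto simp: eventually_cofinite)
      then show "eventually P V" by eventually_elim auto
    qed
    have shift: "f (s n - a) = f (s n) - f a" if "bounded_linear f" for f :: "'a \<Rightarrow> real" and n
      using linear_diff[OF bounded_linear.linear[OF that]] .
    have null: "((\<lambda>n. f (s n - a)) \<longlongrightarrow> 0) V" if "bounded_linear f" for f :: "'a \<Rightarrow> real"
      unfolding shift[OF that] using lim[OF that] by (rule LIM_zero)
    show ?thesis
    proof (rule weakly_null_or_ell1_subsequence[OF V free, of "\<lambda>n. s n - a"])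
      fix f :: "'a \<Rightarrow> real" assume "bounded_linear f"
      then show "((\<lambda>n. f (s n - a)) \<longlongrightarrow> 0) V" by (rule null)
    next
      fix r :: "nat \<Rightarrow> nat"
      assume r: "\<And>f::'a \<Rightarrow> real. bounded_linear f \<Longrightarrow> (\<lambda>n. f (s (r n) - a)) \<longlonglongrightarrow> 0"
      have "limitin weak_unit_ball (s \<circ> r) a sequentially"
      proof (rule limitin_weak_unit_ball[OF na])
        show "norm ((s \<circ> r) i) \<le> 1" for i using s nA by auto
        fix f :: "'a \<Rightarrow> real" assume f: "bounded_linear f"
        show "(\<lambda>n. f ((s \<circ> r) n)) \<longlonglongrightarrow> f a"
          using r[OF f] unfolding shift[OF f] comp_def by (rule LIM_zero_cancel)
      qed
      then show ?thesis using s by (intro exI[of _ "s \<circ> r"]) auto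
    next
      fix r :: "nat \<Rightarrow> nat" and d
      assume d: "d > 0" "ell1_lower_bound d (\<lambda>n. s (r n) - a)"
      have "norm (s (r n) - a) \<le> 2" for n
      proof -
        have "norm (s (r n)) \<le> 1" using s nA by auto
        then show ?thesis using norm_triangle_ineq4[of "s (r n)" a] na by linarith
      qed
      with no_ell1[of "\<lambda>n. s (r n) - a" d] d show ?thesis by blast
    qed
  qed
qed

lemma frechet_urysohn_no_fan:
  assumes "frechet_urysohn_space (weak_unit_ball :: 'a::real_normed_vector topology)"
  shows "\<not> Fin_omega_fan (weak_unit_ball :: 'a topology) F"
proof
  let ?Y = "weak_unit_ball :: 'a topology"
  assume "Fin_omega_fan ?Y F"
  then have F: "\<And>n. F n \<subseteq> topspace ?Y" "\<And>n. finite (F n)"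
    and cf: "compact_finite_family ?Y F" and nlf: "\<not> locally_finite_family ?Y F"
    by (auto simp: Fin_omega_fan_def)
  from nlf obtain y where y: "y \<in> topspace ?Y"
    "\<And>V. openin ?Y V \<Longrightarrow> y \<in> V \<Longrightarrow> infinite {n. F n \<inter> V \<noteq> {}}"
    unfolding locally_finite_family_def by blast
  have "compactin ?Y {y}" using y(1) by simp
  then have "finite {n. F n \<inter> {y} \<noteq> {}}"
    using cf unfolding compact_finite_family_def by blast
  \<comment> \<open>Compactness of the singleton of \<open>y\<close> leaves finitely many members
    containing \<open>y\<close>; dropping them yields a set \<open>A\<close> that avoids
    \<open>y\<close>.\<close>
  then obtain N where N: "\<And>n. n \<ge> N \<Longrightarrow> y \<notin> F n"
    unfolding finite_nat_iff_bounded by (metis (mono_tags, lifting) disjoint_insert(2) lessThan_iff mem_Collect_eq not_le subsetD)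
  define A where "A = (\<Union>n\<in>{N..}. F n)"
  have "y \<in> ?Y closure_of A"
    unfolding in_closure_of
  proof (intro conjI allI impI)
    fix T assume "y \<in> T \<and> openin ?Y T"
    then have "infinite {n. F n \<inter> T \<noteq> {}}" using y(2) by blast
    then obtain n where "n \<ge> N" "F n \<inter> T \<noteq> {}"
      by (metis (mono_tags, lifting) infinite_nat_iff_unbounded_le mem_Collect_eq)
    then show "\<exists>x. x \<in> A \<and> x \<in> T" by (auto simp: A_def)
  qed (rule y(1))
  moreover have "A \<subseteq> topspace ?Y" using F(1) by (auto simp: A_def)
  ultimately obtain s where s: "range s \<subseteq> A" "limitin ?Y s y sequentially"
    using assms unfolding frechet_urysohn_space_def by blast
  have "compactin ?Y (insert y (range s))"
    using s(1) \<open>A \<subseteq> topspace ?Y\<close> by (intro compactin_sequence_with_limit[OF s(2)]) auto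
  then have fin: "finite {n. F n \<inter> insert y (range s) \<noteq> {}}"
    using cf unfolding compact_finite_family_def by blast
  \<comment> \<open>With only finitely many members met, the whole sequence stays in this finite
    set, which misses its limit \<open>y\<close>; separating functionals rule that out.\<close>
  define B where "B = (\<Union>n\<in>{n. F n \<inter> insert y (range s) \<noteq> {}} \<inter> {N..}. F n)"
  have B: "finite B" "y \<notin> B" using fin F(2) N by (auto simp: B_def)
  have sB: "s i \<in> B" for i
  proof -
    obtain n where "n \<ge> N" "s i \<in> F n" using s(1) by (auto simp: A_def)
    then show ?thesis by (auto simp: B_def)
  qed
  have "eventually (\<lambda>i. \<forall>b\<in>B. s i \<noteq> b) sequentially"
  proof (intro eventually_ball_finite ballI B(1))
    fix b assume "b \<in> B"
    then have "y \<noteq> b" using B by auto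
    then obtain f :: "'a \<Rightarrow> real" where f: "bounded_linear f" "f y \<noteq> f b"
      by (rule functional_separates)
    let ?U = "f -` (- {f b}) \<inter> cball 0 1"
    have "openin ?Y ?U"
      by (intro openin_weak_unit_ball_vimage f) auto
    moreover have "y \<in> ?U" using f y(1) by simp
    ultimately have "eventually (\<lambda>i. s i \<in> ?U) sequentially"
      using s(2) unfolding limitin_def by blast
    then show "eventually (\<lambda>i. s i \<noteq> b) sequentially"
      by eventually_elim auto
  qed
  then have "eventually (\<lambda>i. False) sequentially"
    by eventually_elim (use sB in blast)
  then show False by simp
qed

section \<open>Isomorphic copies of \<open>\<ell>\<^sub>1\<close>\<close>

lift_definition unit_ell1 :: "nat \<Rightarrow> ell1" is "\<lambda>i n. if n = i then 1 else 0"
  by (rule summable_finite[of "{_}"]) auto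

lemma Rep_ell1_sum_unit:
  assumes "finite I"
  shows "Rep_ell1 (\<Sum>i\<in>I. c i *\<^sub>R unit_ell1 i) = (\<lambda>n. if n \<in> I then c n else 0)"
  using assms
  by (induction I) (auto simp: zero_ell1.rep_eq plus_ell1.rep_eq scaleR_ell1.rep_eq unit_ell1.rep_eq)

lemma norm_sum_unit_ell1:
  assumes "finite I"
  shows "norm (\<Sum>i\<in>I. c i *\<^sub>R unit_ell1 i) = (\<Sum>i\<in>I. \<bar>c i\<bar>)"
proof -
  have "norm (\<Sum>i\<in>I. c i *\<^sub>R unit_ell1 i) = (\<Sum>n. \<bar>if n \<in> I then c n else 0\<bar>)"
    by (simp add: norm_ell1.rep_eq Rep_ell1_sum_unit[OF assms])
  also have "\<dots> = (\<Sum>i\<in>I. \<bar>if i \<in> I then c i else 0\<bar>)"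
    by (rule suminf_finite[OF assms]) auto
  finally show ?thesis by simp
qed

text \<open>Continuity at 0 in both directions, scaled by linearity, turns the homeomorphism into
  norm estimates. The factor \<open>b / 2\<close> brings the images of the unit vectors into the
  unit ball, and \<open>e\<close> bounds \<open>T\<close> from below.\<close>

lemma isomorphic_copy_ell1D:
  fixes S :: "'a::real_normed_vector set"
  assumes "isomorphic_copy TYPE(ell1) S"
  obtains x :: "nat \<Rightarrow> 'a" and d where "d > 0" "\<And>n. norm (x n) \<le> 1" "ell1_lower_bound d x"
proof -
  obtain T :: "ell1 \<Rightarrow> 'a" and T' where T: "linear T" and h: "homeomorphism UNIV S T T'"
    using assms by (auto simp: isomorphic_copy_def)
  have "continuous_on UNIV T" "continuous_on S T'" and T'T: "\<And>v. T' (T v) = v" and TS: "\<And>v. T v \<in> S"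
    using h by (auto simp: homeomorphism_def)
  obtain b where b: "b > 0" "\<And>v. norm v < b \<Longrightarrow> norm (T v) < 1"
    using \<open>continuous_on UNIV T\<close>[unfolded continuous_on_iff, rule_format, of 0 1] linear_0[OF T]
    by (auto simp: dist_norm)
  have "0 \<in> S" using TS[of 0] linear_0[OF T] by simp
  moreover have "T' 0 = 0" using T'T[of 0] linear_0[OF T] by simp
  ultimately obtain e where e: "e > 0" "\<And>y. y \<in> S \<Longrightarrow> norm y < e \<Longrightarrow> norm (T' y) < 1"
    using \<open>continuous_on S T'\<close>[unfolded continuous_on_iff, rule_format, of 0 1]
    by (auto simp: dist_norm)
  have lower: "e * norm v \<le> norm (T v)" for v
  proof (cases "v = 0")
    case False
    let ?u = "inverse (norm v) *\<^sub>R v"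
    have "norm ?u = 1" using False by simp
    then have "e \<le> norm (T ?u)"
      using e(2)[OF TS, of ?u] T'T by (metis less_irrefl not_le)
    also have "\<dots> = inverse (norm v) * norm (T v)"
      by (simp add: linear_scale[OF T])
    finally show ?thesis using False by (simp add: field_simps)
  qed simp
  define x where "x i = T ((b / 2) *\<^sub>R unit_ell1 i)" for i
  have unit: "norm (unit_ell1 i) = 1" for i
    using norm_sum_unit_ell1[of "{i}" "\<lambda>_. 1"] by simp
  have "norm (x i) \<le> 1" for i
    unfolding x_def by (intro less_imp_le b(2)) (use b(1) unit in simp)
  moreover have "ell1_lower_bound (e * (b / 2)) x"
    unfolding ell1_lower_bound_def
  proof (intro allI impI)
    fix I :: "nat set" and c :: "nat \<Rightarrow> real" assume I: "finite I"
    have "e * (b / 2) * (\<Sum>i\<in>I. \<bar>c i\<bar>) = e * (\<Sum>i\<in>I. \<bar>c i * (b / 2)\<bar>)"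
      using b(1) by (simp add: abs_mult sum_distrib_left mult_ac)
    also have "\<dots> = e * norm (\<Sum>i\<in>I. (c i * (b / 2)) *\<^sub>R unit_ell1 i)"
      by (simp only: norm_sum_unit_ell1[OF I])
    also have "\<dots> \<le> norm (T (\<Sum>i\<in>I. (c i * (b / 2)) *\<^sub>R unit_ell1 i))"
      by (rule lower)
    also have "T (\<Sum>i\<in>I. (c i * (b / 2)) *\<^sub>R unit_ell1 i) = (\<Sum>i\<in>I. c i *\<^sub>R x i)"
      by (simp add: linear_sum[OF T] linear_scale[OF T] x_def)
    finally show "e * (b / 2) * (\<Sum>i\<in>I. \<bar>c i\<bar>) \<le> norm (\<Sum>i\<in>I. c i *\<^sub>R x i)" .
  qed
  ultimately show ?thesis
    using b(1) e(1) by (intro that[of "e * (b / 2)" x]) auto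
qed

text \<open>Completeness lets the series defining \<open>T\<close> converge absolutely. The lower
  bound passes from partial sums to \<open>T\<close>, which gives injectivity and a Lipschitz
  inverse on the range.\<close>

lemma isomorphic_copy_ell1I:
  fixes x :: "nat \<Rightarrow> 'a::banach"
  assumes d: "d > 0" and bounded: "\<And>n. norm (x n) \<le> C" and lower: "ell1_lower_bound d x"
  obtains S :: "'a set" where "isomorphic_copy TYPE(ell1) S"
proof -
  have C: "C \<ge> 0" using norm_ge_zero order_trans bounded by blast
  have summable_Rep: "summable (\<lambda>n. \<bar>Rep_ell1 v n\<bar>)" for v using Rep_ell1 by auto
  have le: "norm (Rep_ell1 v n *\<^sub>R x n) \<le> C * \<bar>Rep_ell1 v n\<bar>" for v n
    using mult_left_mono[OF bounded[of n] abs_ge_zero[of "Rep_ell1 v n"]] by (simp add: mult.commute)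
  have summable: "summable (\<lambda>n. Rep_ell1 v n *\<^sub>R x n)" for v
    by (rule summable_comparison_test'[OF summable_mult[OF summable_Rep] le])
  define T where "T v = (\<Sum>n. Rep_ell1 v n *\<^sub>R x n)" for v
  have "linear T"
  proof (rule linearI)
    show "T (v + w) = T v + T w" for v w
      unfolding T_def by (simp add: plus_ell1.rep_eq scaleR_add_left suminf_add summable)
    show "T (c *\<^sub>R v) = c *\<^sub>R T v" for c v
      unfolding T_def
      by (simp add: scaleR_ell1.rep_eq suminf_scaleR_right[OF summable])
  qed
  have upper: "norm (T v) \<le> norm v * C" for v
  proof -
    have "norm (T v) \<le> (\<Sum>n. C * \<bar>Rep_ell1 v n\<bar>)"
      unfolding T_def by (rule norm_suminf_le[OF le summable_mult[OF summable_Rep]])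
    also have "\<dots> = norm v * C"
      by (simp add: norm_ell1.rep_eq suminf_mult[OF summable_Rep])
    finally show ?thesis .
  qed
  have low: "d * norm v \<le> norm (T v)" for v
  proof (rule tendsto_le)
    show "(\<lambda>N. norm (\<Sum>n<N. Rep_ell1 v n *\<^sub>R x n)) \<longlonglongrightarrow> norm (T v)"
      unfolding T_def by (intro tendsto_norm summable_LIMSEQ summable)
    show "(\<lambda>N. d * (\<Sum>n<N. \<bar>Rep_ell1 v n\<bar>)) \<longlonglongrightarrow> d * norm v"
      unfolding norm_ell1.rep_eq by (intro tendsto_intros summable_LIMSEQ summable_Rep)
  qed (simp_all add: ell1_lower_boundD[OF lower])
  have inj: "inj T"
    unfolding linear_injective_0[OF \<open>linear T\<close>] using low d
    by (metis mult_pos_pos norm_zero not_le zero_less_norm_iff)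
  have contT: "continuous_on UNIV T"
    using \<open>linear T\<close> upper
    by (intro linear_continuous_on bounded_linear_intro[where K = C]) (auto simp: linear_add linear_scale)
  have contT': "continuous_on (range T) (inv T)"
    unfolding continuous_on_iff
  proof (intro ballI allI impI)
    fix y and e :: real assume "y \<in> range T" "e > 0"
    have "dist (inv T z) (inv T y) < e" if "z \<in> range T" "dist z y < d * e" for z
    proof -
      obtain v w where vw: "z = T v" "y = T w"
        using \<open>y \<in> range T\<close> \<open>z \<in> range T\<close> by blast
      have "d * norm (v - w) \<le> norm (T v - T w)"
        using low[of "v - w"] by (simp add: linear_diff[OF \<open>linear T\<close>])
      also have "\<dots> < d * e" using that(2) vw by (simp add: dist_norm)
      finally show ?thesis using d vw inj by (simp add: dist_norm)
    qed
    then show "\<exists>b>0. \<forall>z\<in>range T. dist z y < b \<longrightarrow> dist (inv T z) (inv T y) < e"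
      using d \<open>e > 0\<close> by (intro exI[of _ "d * e"]) auto
  qed
  have "homeomorphism UNIV (range T) T (inv T)"
    using inj by (intro homeomorphismI contT contT') (auto simp: f_inv_into_f)
  moreover have "subspace (range T)"
    using \<open>linear T\<close> by (intro linear_subspace_image subspace_UNIV)
  ultimately show ?thesis
    using \<open>linear T\<close> that[of "range T"] unfolding isomorphic_copy_def by blast
qed

section \<open>Finitely additive averages over subsets of \<open>\<nat>\<close>\<close>

text \<open>Only finite additivity can be expected: the limit of averages used below gives mass 1 to
  the countable set of all finite sets and mass 0 to each of them.\<close>

definition charge :: "('a set \<Rightarrow> real) \<Rightarrow> bool" where
  "charge \<mu> \<longleftrightarrow> (\<forall>A. 0 \<le> \<mu> A) \<and> \<mu> UNIV \<le> 1 \<and> (\<forall>A B. A \<inter> B = {} \<longrightarrow> \<mu> (A \<union> B) = \<mu> A + \<mu> B)"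

lemma charge_nonneg: "charge \<mu> \<Longrightarrow> 0 \<le> \<mu> A"
  by (simp add: charge_def)

lemma charge_disjoint_Un: "charge \<mu> \<Longrightarrow> A \<inter> B = {} \<Longrightarrow> \<mu> (A \<union> B) = \<mu> A + \<mu> B"
  by (simp add: charge_def)

lemma charge_empty: "charge \<mu> \<Longrightarrow> \<mu> {} = 0"
  using charge_disjoint_Un[of \<mu> "{}" "{}"] by simp

lemma charge_Un_Int:
  assumes "charge \<mu>"
  shows "\<mu> (A \<union> B) + \<mu> (A \<inter> B) = \<mu> A + \<mu> B"
proof -
  have "\<mu> (A \<union> (B - A)) = \<mu> A + \<mu> (B - A)" "\<mu> ((A \<inter> B) \<union> (B - A)) = \<mu> (A \<inter> B) + \<mu> (B - A)"
    by (rule charge_disjoint_Un[OF assms]; blast)+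
  moreover have "(A \<inter> B) \<union> (B - A) = B" by blast
  ultimately show ?thesis by simp
qed

lemma charge_le_1:
  assumes "charge \<mu>"
  shows "\<mu> A \<le> 1"
proof -
  have "\<mu> UNIV \<le> 1" using assms by (simp add: charge_def)
  then show ?thesis
    using charge_disjoint_Un[OF assms, of A "- A"] charge_nonneg[OF assms, of "- A"] by simp
qed

lemma charge_Int_UN_le:
  assumes \<mu>: "charge \<mu>" and "finite I"
  shows "\<mu> ((\<Union>i\<in>I. A i) \<inter> B) \<le> (\<Sum>i\<in>I. \<mu> (A i \<inter> B))"
  using assms(2)
proof (induction I)
  case empty
  then show ?case by (simp add: charge_empty[OF \<mu>])
next
  case (insert i I)
  have "\<mu> ((\<Union>i\<in>insert i I. A i) \<inter> B) = \<mu> ((A i \<inter> B) \<union> ((\<Union>i\<in>I. A i) \<inter> B))"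
    by (simp add: Int_Un_distrib2)
  also have "\<dots> \<le> \<mu> (A i \<inter> B) + \<mu> ((\<Union>i\<in>I. A i) \<inter> B)"
    using charge_Un_Int[OF \<mu>, of "A i \<inter> B" "(\<Union>i\<in>I. A i) \<inter> B"] charge_nonneg[OF \<mu>]
    by (metis add.commute le_add_same_cancel2)
  finally show ?case using insert by simp
qed

text \<open>Each new set overlaps the union of the earlier ones in mass at most
  \<open>K * b\<close>, so it contributes at least half of \<open>c\<close>.\<close>

lemma charge_almost_disjoint:
  assumes \<mu>: "charge \<mu>" and large: "\<And>i. \<mu> (A i) \<ge> c" and small: "\<And>i j. i < j \<Longrightarrow> \<mu> (A i \<inter> A j) \<le> b"
    and b: "real K * b \<le> c / 2" "b \<ge> 0" and k: "k \<le> K"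
  shows "real k * (c / 2) \<le> \<mu> (\<Union>i<k. A i)"
  using k
proof (induction k)
  case 0
  then show ?case by (simp add: charge_nonneg[OF \<mu>])
next
  case (Suc k)
  have "\<mu> ((\<Union>i<k. A i) \<inter> A k) \<le> (\<Sum>i<k. \<mu> (A i \<inter> A k))"
    by (rule charge_Int_UN_le[OF \<mu>]) simp
  also have "\<dots> \<le> (\<Sum>i<k. b)"
    by (intro sum_mono small) simp
  also have "\<dots> \<le> real K * b"
    using Suc.prems b(2) by (simp add: mult_right_mono)
  also have "\<dots> \<le> c / 2" by (rule b(1))
  finally have "\<mu> ((\<Union>i<k. A i) \<inter> A k) \<le> c / 2" .
  moreover have "\<mu> ((\<Union>i<k. A i) \<union> A k) + \<mu> ((\<Union>i<k. A i) \<inter> A k) = \<mu> (\<Union>i<k. A i) + \<mu> (A k)"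
    by (rule charge_Un_Int[OF \<mu>])
  moreover have "(\<Union>i<Suc k. A i) = (\<Union>i<k. A i) \<union> A k"
    by (auto simp: less_Suc_eq)
  ultimately show ?case
    using Suc large[of k] by (simp add: algebra_simps)
qed

text \<open>Otherwise almost every \<open>A i\<close> would meet almost every \<open>A j\<close> in
  arbitrarily small mass. A thread of \<open>K\<close> sets with small pairwise overlaps would then
  have total mass above 1.\<close>

lemma charge_intersection_step:
  fixes V :: "nat filter"
  assumes V: "ultra V" "V \<le> sequentially" and \<mu>: "charge \<mu>"
    and c: "c > 0" "eventually (\<lambda>j. \<mu> (A j) \<ge> c) V"
  shows "eventually (\<lambda>i. \<exists>b>0. eventually (\<lambda>j. \<mu> (A i \<inter> A j) \<ge> b) V) V"
proof (rule ccontr)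
  define bad where "bad i \<longleftrightarrow> \<not> (\<exists>b>0. eventually (\<lambda>j. \<mu> (A i \<inter> A j) \<ge> b) V)" for i
  assume "\<not> ?thesis"
  then have bad: "eventually bad V"
    unfolding bad_def using ultra_not_eventually[OF V(1)] by blast
  obtain K where K: "real K * (c / 2) > 1"
    using c(1) reals_Archimedean3[of "c / 2"] by (metis half_gt_zero)
  then have "K > 0" by (cases K) auto
  \<comment> \<open>\<open>K\<close> half-masses \<open>c / 2\<close> exceed 1, and \<open>b\<close>
    is such that \<open>K\<close> overlaps cost at most \<open>c / 2\<close>.\<close>
  define b where "b = c / (2 * real K)"
  have b: "b > 0" "real K * b \<le> c / 2"
    using c(1) \<open>K > 0\<close> by (simp_all add: b_def)
  define Q where "Q N \<longleftrightarrow> (\<forall>i\<in>N. bad i \<and> \<mu> (A i) \<ge> c)" for N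
  have step: "eventually (\<lambda>n. Q (insert n N) \<and> (\<forall>i\<in>N. \<mu> (A i \<inter> A n) < b)) V" if N: "finite N" "Q N" for N
  proof -
    have "eventually (\<lambda>n. \<forall>i\<in>N. \<mu> (A i \<inter> A n) < b) V"
    proof (intro eventually_ball_finite N(1) ballI)
      fix i assume "i \<in> N"
      then have "\<not> eventually (\<lambda>n. \<mu> (A i \<inter> A n) \<ge> b) V"
        using N(2) b(1) by (auto simp: Q_def bad_def)
      then show "eventually (\<lambda>n. \<mu> (A i \<inter> A n) < b) V"
        unfolding ultra_not_eventually[OF V(1)] by (simp add: not_le)
    qed
    with bad c(2) show ?thesis
      by eventually_elim (use N(2) in \<open>auto simp: Q_def\<close>)
  qed
  have "\<exists>r :: nat \<Rightarrow> nat. (\<forall>k. Q (r ` {..<k})) \<and> (\<forall>k. \<forall>i\<in>r ` {..<k}. \<mu> (A i \<inter> A (r k)) < b)"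
  proof (rule ultra_thread[OF ultra_nonbot[OF V(1)] V(2), of Q "\<lambda>N n. \<forall>i\<in>N. \<mu> (A i \<inter> A n) < b"])
    show "Q {}" by (simp add: Q_def)
  qed (use step in auto)
  then obtain r :: "nat \<Rightarrow> nat" where r: "\<And>k. Q (r ` {..<k})"
      "\<And>k. \<forall>i\<in>r ` {..<k}. \<mu> (A i \<inter> A (r k)) < b"
    by blast
  have "real K * (c / 2) \<le> \<mu> (\<Union>i<K. A (r i))"
  proof (rule charge_almost_disjoint[OF \<mu>])
    show "c \<le> \<mu> (A (r i))" for i
      using r(1)[of "Suc i"] by (auto simp: Q_def)
    show "\<mu> (A (r i) \<inter> A (r j)) \<le> b" if "i < j" for i j
      using r(2)[of j] that by (auto intro: less_imp_le)
  qed (use b in auto)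
  with K charge_le_1[OF \<mu>] show False by (meson less_le_trans not_less)
qed

text \<open>The invariant asks more than a nonempty intersection: the sets chosen so far must meet
  almost all remaining \<open>E j\<close> in mass bounded below. The preceding lemma, applied to the
  traces of the \<open>E j\<close> on the current intersection, preserves this.\<close>

lemma charge_intersecting_subsequence:
  assumes \<mu>: "charge \<mu>" and c: "c > 0" "\<And>j::nat. \<mu> (E j) \<ge> c"
  obtains r :: "nat \<Rightarrow> nat" where "strict_mono r" "\<And>k. (\<Inter>i<k. E (r i)) \<noteq> {}"
proof -
  obtain V :: "nat filter" where V: "V \<le> sequentially" "ultra V"
    using ultra_exists[OF sequentially_bot] .
  define Q where "Q N \<longleftrightarrow> (\<exists>b>0. eventually (\<lambda>j. \<mu> ((\<Inter>i\<in>N. E i) \<inter> E j) \<ge> b) V)" for N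
  have "\<exists>r :: nat \<Rightarrow> nat. strict_mono r \<and> (\<forall>k. Q (r ` {..<k}))"
  proof (rule ultra_thread[OF ultra_nonbot[OF V(2)] V(1), of Q "\<lambda>_ _. True"])
    show "Q {}" using c by (auto simp: Q_def)
    fix N assume "Q N"
    then obtain b where b: "b > 0" "eventually (\<lambda>j. \<mu> ((\<Inter>i\<in>N. E i) \<inter> E j) \<ge> b) V"
      by (auto simp: Q_def)
    have "(\<Inter>i\<in>insert n N. E i) \<inter> E j = ((\<Inter>i\<in>N. E i) \<inter> E n) \<inter> ((\<Inter>i\<in>N. E i) \<inter> E j)" for n j
      by auto
    then show "eventually (\<lambda>n. Q (insert n N) \<and> True) V"
      using charge_intersection_step[OF V(2,1) \<mu> b] by (simp add: Q_def)
  qed auto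
  then obtain r :: "nat \<Rightarrow> nat" where r: "strict_mono r" "\<And>k. Q (r ` {..<k})" by blast
  have "(\<Inter>i<k. E (r i)) \<noteq> {}" for k
  proof
    assume empty: "(\<Inter>i<k. E (r i)) = {}"
    obtain b where "b > 0" "eventually (\<lambda>j. \<mu> ((\<Inter>i\<in>r ` {..<k}. E i) \<inter> E j) \<ge> b) V"
      using r(2)[of k] by (auto simp: Q_def)
    then show False
      using empty ultra_nonbot[OF V(2)] by (simp add: charge_empty[OF \<mu>])
  qed
  with r(1) show ?thesis by (rule that)
qed

text \<open>A substitute for dominated convergence, which fails for charges in general: the limit
  functionals of the family are not in the family, but weak convergence controls them too.\<close>

lemma weakly_null_charge:
  fixes z :: "nat \<Rightarrow> 'a::real_normed_vector"
  assumes \<mu>: "charge \<mu>" and f: "\<And>A. bdd_functional C (f A)"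
    and null: "\<And>g. bounded_linear g \<Longrightarrow> (\<lambda>n. g (z n) :: real) \<longlonglongrightarrow> 0"
    and h: "h > 0" and c: "c > 0"
  shows "\<exists>j. \<mu> {A. \<bar>f A (z j)\<bar> \<ge> h} < c"
proof (rule ccontr)
  assume "\<not> ?thesis"
  then have large: "\<And>j. \<mu> {A. \<bar>f A (z j)\<bar> \<ge> h} \<ge> c" by (simp add: not_less)
  \<comment> \<open>The finite intersection property gives, for each \<open>k\<close>, one pattern
    \<open>A k\<close> that is large at the first \<open>k\<close> selected terms; an ultralimit of
    the \<open>f (A k)\<close> is then large at all of them.\<close>
  obtain r :: "nat \<Rightarrow> nat" where r: "strict_mono r" "\<And>k. (\<Inter>i<k. {A. \<bar>f A (z (r i))\<bar> \<ge> h}) \<noteq> {}"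
    by (rule charge_intersecting_subsequence[of \<mu> c "\<lambda>j. {A. \<bar>f A (z j)\<bar> \<ge> h}", OF \<mu> c large]) blast
  have "\<forall>k. \<exists>A. \<forall>i<k. \<bar>f A (z (r i))\<bar> \<ge> h" using r(2) by fastforce
  then obtain A where A: "\<And>k i. i < k \<Longrightarrow> \<bar>f (A k) (z (r i))\<bar> \<ge> h" by metis
  obtain V :: "nat filter" where V: "V \<le> sequentially" "ultra V"
    using ultra_exists[OF sequentially_bot] .
  obtain g where g: "bdd_functional C g" "\<And>x. ((\<lambda>k. f (A k) x) \<longlongrightarrow> g x) V"
    using bdd_functional_ultralimit[OF V(2), of C "\<lambda>k. f (A k)"] f by metis
  have ge: "h \<le> \<bar>g (z (r i))\<bar>" for i
  proof (rule tendsto_lowerbound)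
    show "((\<lambda>k. \<bar>f (A k) (z (r i))\<bar>) \<longlongrightarrow> \<bar>g (z (r i))\<bar>) V"
      by (intro tendsto_intros g)
    have "eventually (\<lambda>k. i < k) V"
      by (rule filter_leD[OF V(1) eventually_gt_at_top])
    then show "eventually (\<lambda>k. h \<le> \<bar>f (A k) (z (r i))\<bar>) V"
      by eventually_elim (rule A)
  qed (rule ultra_nonbot[OF V(2)])
  have "(\<lambda>n. g (z n)) \<longlonglongrightarrow> 0"
    by (rule null[OF bdd_functional_bounded_linear[OF g(1)]])
  then have "(\<lambda>i. g (z (r i))) \<longlonglongrightarrow> 0"
    using LIMSEQ_subseq_LIMSEQ[OF _ r(1)] by (fastforce simp: comp_def)
  then have "eventually (\<lambda>i. \<bar>g (z (r i))\<bar> < h) sequentially"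
    using h tendstoD by (fastforce simp: dist_real_def)
  then have "eventually (\<lambda>i. False) sequentially"
    by eventually_elim (use ge in \<open>simp add: not_less[symmetric]\<close>)
  then show False by simp
qed

section \<open>Rademacher functions and averages over finite sign patterns\<close>

definition avg :: "nat \<Rightarrow> (nat set \<Rightarrow> real) \<Rightarrow> real" where
  "avg N u = (\<Sum>A\<in>Pow {..<N}. u A) / 2 ^ N"

lemma avg_add: "avg N (\<lambda>A. u A + v A) = avg N u + avg N v"
  by (simp add: avg_def sum.distrib add_divide_distrib)

lemma avg_diff: "avg N (\<lambda>A. u A - v A) = avg N u - avg N v"
  by (simp add: avg_def sum_subtractf diff_divide_distrib)

lemma avg_mult: "avg N (\<lambda>A. c * u A) = c * avg N u"
  by (simp add: avg_def sum_distrib_left)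

lemma avg_sum: "avg N (\<lambda>A. \<Sum>i\<in>I. u i A) = (\<Sum>i\<in>I. avg N (u i))"
  unfolding avg_def by (subst sum.swap) (simp add: sum_divide_distrib)

lemma avg_const: "avg N (\<lambda>A. c) = c"
  by (simp add: avg_def card_Pow)

lemma avg_mono: "(\<And>A. u A \<le> v A) \<Longrightarrow> avg N u \<le> avg N v"
  by (simp add: avg_def divide_right_mono sum_mono)

lemma avg_abs: "\<bar>avg N u\<bar> \<le> avg N (\<lambda>A. \<bar>u A\<bar>)"
  by (simp add: avg_def divide_right_mono sum_abs)

text \<open>A set encodes a sign pattern, with plus at its elements. Under \<open>avg N\<close> the
  first \<open>N\<close> signs vary freely and all later ones are minus.\<close>

definition rademacher :: "nat \<Rightarrow> nat set \<Rightarrow> real" where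
  "rademacher i A = (if i \<in> A then 1 else - 1)"

lemma abs_rademacher: "\<bar>rademacher i A\<bar> = 1"
  by (simp add: rademacher_def)

lemma rademacher_square: "rademacher i A * rademacher i A = 1"
  by (simp add: rademacher_def)

text \<open>Toggling the membership of \<open>i\<close> is an involution of the subsets that changes
  the sign of the product. The other index \<open>j\<close> may lie beyond \<open>N\<close>.\<close>

lemma avg_rademacher_mult:
  assumes "i < N" "i \<noteq> j"
  shows "avg N (\<lambda>A. rademacher i A * rademacher j A) = 0"
proof -
  define t where "t A = (if i \<in> A then A - {i} else insert i A)" for A
  let ?s = "\<Sum>A\<in>Pow {..<N}. rademacher i A * rademacher j A"
  have "?s = (\<Sum>A\<in>Pow {..<N}. - (rademacher i A * rademacher j A))"
    by (rule sum.reindex_bij_witness[of _ t t])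
       (use assms in \<open>auto simp: t_def rademacher_def split: if_splits\<close>)
  also have "\<dots> = - ?s" by (rule sum_negf)
  finally show ?thesis by (simp add: avg_def)
qed

lemma avg_bessel:
  assumes "M \<subseteq> {..<N}"
  shows "(\<Sum>n\<in>M. (avg N (\<lambda>A. rademacher n A * u A))\<^sup>2) \<le> avg N (\<lambda>A. (u A)\<^sup>2)"
proof -
  have M: "finite M" using assms finite_subset by blast
  define c where "c n = avg N (\<lambda>A. rademacher n A * u A)" for n
  have ortho: "avg N (\<lambda>A. rademacher n A * rademacher m A) = (if n = m then 1 else 0)" if "n \<in> M" for n m
    using that assms avg_rademacher_mult[of n N m] by (auto simp: rademacher_square avg_const)
  have "0 = avg N (\<lambda>A. 0)" by (simp add: avg_const)
  also have "\<dots> \<le> avg N (\<lambda>A. (u A - (\<Sum>n\<in>M. c n * rademacher n A))\<^sup>2)"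
    by (rule avg_mono) simp
  also have "(\<lambda>A. (u A - (\<Sum>n\<in>M. c n * rademacher n A))\<^sup>2) =
     (\<lambda>A. ((u A)\<^sup>2 - 2 * (\<Sum>n\<in>M. c n * (rademacher n A * u A))) +
        (\<Sum>n\<in>M. \<Sum>m\<in>M. (c n * c m) * (rademacher n A * rademacher m A)))"
    by (rule ext)
       (simp add: power2_diff power2_eq_square[of "sum _ _"] sum_product sum_distrib_left mult_ac)
  also have "avg N \<dots> = (avg N (\<lambda>A. (u A)\<^sup>2) - 2 * (\<Sum>n\<in>M. c n * c n)) +
      (\<Sum>n\<in>M. \<Sum>m\<in>M. (c n * c m) * (if n = m then 1 else 0))"
    by (simp add: avg_add avg_diff avg_mult avg_sum ortho flip: c_def cong: sum.cong)
  also have "(\<Sum>n\<in>M. \<Sum>m\<in>M. (c n * c m) * (if n = m then 1 else 0)) = (\<Sum>n\<in>M. c n * c n)"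
    using M by (simp add: sum.delta' if_distrib cong: if_cong)
  finally show ?thesis
    by (simp add: power2_eq_square c_def)
qed

lemma charge_avg_ultralimit:
  assumes V: "ultra V"
  obtains \<mu> where "charge \<mu>" "\<And>E. ((\<lambda>N. avg N (indicator E)) \<longlongrightarrow> \<mu> E) V"
proof -
  have bounds: "0 \<le> avg N (indicator E)" "avg N (indicator E) \<le> 1" for N and E :: "nat set set"
    using avg_mono[of "\<lambda>_. 0" "indicator E" N] avg_mono[of "indicator E" "\<lambda>_. 1" N]
    by (simp_all add: avg_const indicator_def)
  have "\<exists>l. ((\<lambda>N. avg N (indicator E)) \<longlongrightarrow> l) V" for E :: "nat set set"
    using ultra_tendsto_bounded[OF V, of "\<lambda>N. avg N (indicator E)" 1] bounds by (metis abs_of_nonneg)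
  then obtain \<mu> where \<mu>: "\<And>E :: nat set set. ((\<lambda>N. avg N (indicator E)) \<longlongrightarrow> \<mu> E) V"
    by metis
  note V' = ultra_nonbot[OF V]
  have "charge \<mu>"
    unfolding charge_def
  proof (intro conjI allI impI)
    show "0 \<le> \<mu> A" for A
      by (rule tendsto_lowerbound[OF \<mu> _ V']) (use bounds in auto)
    show "\<mu> UNIV \<le> 1"
      by (rule tendsto_upperbound[OF \<mu> _ V']) (rule always_eventually, rule allI, rule bounds(2))
    fix A B :: "nat set set" assume "A \<inter> B = {}"
    then have "(indicator (A \<union> B) :: _ \<Rightarrow> real) = (\<lambda>x. indicator A x + indicator B x)"
      by (auto simp: fun_eq_iff indicator_def)
    then have "avg N (indicator (A \<union> B)) = avg N (indicator A) + avg N (indicator B)" for N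
      by (simp add: avg_add)
    then have "((\<lambda>N. avg N (indicator (A \<union> B))) \<longlongrightarrow> \<mu> A + \<mu> B) V"
      using tendsto_add[OF \<mu> \<mu>] by simp
    then show "\<mu> (A \<union> B) = \<mu> A + \<mu> B"
      by (rule tendsto_unique[OF V' \<mu>])
  qed
  then show ?thesis using \<mu> by (rule that)
qed

section \<open>A strong fan in the presence of \<open>\<ell>\<^sub>1\<close>\<close>

text \<open>A shifted \<open>\<ell>\<^sub>1\<close>-sequence in a weakly compact set violates Grothendieck's double limit
  criterion: the functionals \<open>h N\<close> below vanish on the first \<open>N\<close> terms and are \<open>1\<close> on the others.\<close>

lemma weakly_compact_no_ell1:
  fixes y :: "nat \<Rightarrow> 'a::real_normed_vector"
  assumes K: "compactin weak_unit_ball K" "\<And>n. y n \<in> K" and d: "d > 0"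
  shows "\<not> ell1_lower_bound d (\<lambda>n. y n - l)"
proof
  assume ell1: "ell1_lower_bound d (\<lambda>n. y n - l)"
  obtain V :: "nat filter" where V: "V \<le> sequentially" "ultra V"
    using ultra_exists[OF sequentially_bot] .
  note V' = ultra_nonbot[OF V(2)]
  obtain p where "p \<in> K" and p: "\<And>f::'a \<Rightarrow> real. bounded_linear f \<Longrightarrow> ((\<lambda>n. f (y n)) \<longlongrightarrow> f p) V"
    using weakly_compact_ultralimit[of V K y, OF V(2) K] by blast
  have lim: "((\<lambda>n. f (y n - l)) \<longlongrightarrow> f (p - l)) V" if "bdd_functional C f" for C and f :: "'a \<Rightarrow> real"
    using tendsto_diff[OF p[OF bdd_functional_bounded_linear[OF that]] tendsto_const[of "f l"]]
    by (simp add: linear_diff[OF bdd_functional_linear[OF that]])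
  have "\<exists>h. bdd_functional (1 / d) h \<and> (\<forall>i. h (y i - l) = (if i \<ge> N then 1 else 0))" for N :: nat
  proof -
    obtain h where "bdd_functional (1 / d) h" "\<And>i. h (y i - l) = (if i \<ge> N then 1 else 0)"
      by (rule ell1_functional[OF d ell1, of "\<lambda>i. if i \<ge> N then 1 else 0"]) auto
    then show ?thesis by blast
  qed
  then obtain h where h: "\<And>N. bdd_functional (1 / d) (h N)"
      "\<And>N i. h N (y i - l) = (if i \<ge> N then 1 else 0)"
    by metis
  have hp: "h N (p - l) = 1" for N
  proof (rule tendsto_unique[OF V' lim[OF h(1)]])
    have "eventually (\<lambda>i. N \<le> i) V" by (rule filter_leD[OF V(1) eventually_ge_at_top])
    then have "eventually (\<lambda>i. h N (y i - l) = 1) V"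
      by eventually_elim (simp add: h(2))
    then show "((\<lambda>n. h N (y n - l)) \<longlongrightarrow> 1) V" by (rule tendsto_eventually)
  qed
  \<comment> \<open>The iterated limits disagree: \<open>g\<close> vanishes at every term, hence at
    \<open>p - l\<close>, while every \<open>h N\<close> is 1 there.\<close>
  obtain g where g: "bdd_functional (1 / d) g" "\<And>x. ((\<lambda>N. h N x) \<longlongrightarrow> g x) V"
    using bdd_functional_ultralimit[OF V(2), of "1 / d" h] h(1) by metis
  have "g (y i - l) = 0" for i
  proof (rule tendsto_unique[OF V' g(2)])
    have "eventually (\<lambda>N. i < N) V" by (rule filter_leD[OF V(1) eventually_gt_at_top])
    then have "eventually (\<lambda>N. h N (y i - l) = 0) V"
      by eventually_elim (simp add: h(2))
    then show "((\<lambda>N. h N (y i - l)) \<longlongrightarrow> 0) V" by (rule tendsto_eventually)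
  qed
  then have "g (p - l) = 0"
    using tendsto_unique[OF V' lim[OF g(1)], of 0] by simp
  moreover have "g (p - l) = 1"
    using tendsto_unique[OF V' g(2)[of "p - l"], of 1] by (simp add: hp)
  ultimately show False by simp
qed

lemma R_open_functional:
  fixes f :: "'a::real_normed_vector \<Rightarrow> real"
  assumes f: "bounded_linear f"
  shows "R_open weak_unit_ball {y \<in> cball 0 1. \<bar>f y\<bar> > b}"
  unfolding R_open_def
proof (intro conjI ballI)
  fix y assume y: "y \<in> {y \<in> cball 0 1. \<bar>f y\<bar> > b}"
  \<comment> \<open>An affine function of the modulus, clipped to the unit interval: 0 up to the
    level \<open>b\<close> and 1 at the value of \<open>f\<close> in \<open>y\<close>.\<close>
  define h where "h t = max 0 (min 1 ((\<bar>t\<bar> - b) / (\<bar>f y\<bar> - b)))" for t :: real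
  have "continuous_map weak_unit_ball euclidean f"
    unfolding continuous_map_def
  proof (intro conjI allI impI)
    fix U :: "real set" assume "openin euclidean U"
    then have "openin weak_unit_ball (f -` U \<inter> cball 0 1)"
      using f by (intro openin_weak_unit_ball_vimage) auto
    moreover have "f -` U \<inter> cball 0 1 = {x \<in> topspace weak_unit_ball. f x \<in> U}" by auto
    ultimately show "openin weak_unit_ball {x \<in> topspace weak_unit_ball. f x \<in> U}" by simp
  qed simp
  moreover have "continuous_map euclidean euclidean h"
    unfolding h_def using y by (auto intro!: continuous_intros)
  ultimately have "continuous_map weak_unit_ball euclidean (h \<circ> f)"
    by (rule continuous_map_compose)
  then have cont: "continuous_map weak_unit_ball (top_of_set {0..1}) (h \<circ> f)"
    by (auto simp: continuous_map_in_subtopology h_def)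
  have y1: "(h \<circ> f) y = 1" using y by (simp add: h_def)
  have "h t = 0" if "\<bar>t\<bar> \<le> b" for t
    using divide_nonpos_pos[of "\<bar>t\<bar> - b" "\<bar>f y\<bar> - b"] that y by (simp add: h_def)
  then have h0: "(h \<circ> f) ` (topspace weak_unit_ball - {y \<in> cball 0 1. \<bar>f y\<bar> > b}) \<subseteq> {0}"
    unfolding image_subset_iff by (simp add: not_less)
  show "\<exists>g. continuous_map weak_unit_ball (top_of_set {0..1::real}) g \<and> g y = 1 \<and>
      g ` (topspace weak_unit_ball - {y \<in> cball 0 1. \<bar>f y\<bar> > b}) \<subseteq> {0}"
    by (rule exI[of _ "h \<circ> f"]) (intro conjI cont y1 h0)
qed auto

text \<open>For infinitely many \<open>n\<close> the values of finitely many functionals at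
  \<open>x n\<close> lie within \<open>e / 2\<close> of their ultralimits, so any two such terms
  differ by a vector of the given neighbourhood of 0. The bound \<open>1 / 2\<close> keeps
  differences in the ball.\<close>

lemma differences_not_locally_finite:
  fixes x :: "nat \<Rightarrow> 'a::real_normed_vector"
  assumes x: "\<And>n. norm (x n) \<le> 1 / 2"
  shows "\<not> locally_finite_family weak_unit_ball (\<lambda>n. (\<lambda>i. x n - x i) ` {..<n})"
proof
  assume "locally_finite_family weak_unit_ball (\<lambda>n. (\<lambda>i. x n - x i) ` {..<n})"
  then have "\<exists>U. openin weak_unit_ball U \<and> 0 \<in> U \<and> finite {n. (\<lambda>i. x n - x i) ` {..<n} \<inter> U \<noteq> {}}"
    unfolding locally_finite_family_def by (rule bspec) simp
  then obtain U where U: "openin weak_unit_ball U" "0 \<in> U"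
    "finite {n. (\<lambda>i. x n - x i) ` {..<n} \<inter> U \<noteq> {}}"
    by (elim exE conjE)
  obtain \<Phi> e where \<Phi>: "finite \<Phi>" "\<And>f. f \<in> \<Phi> \<Longrightarrow> bounded_linear f" "e > (0::real)"
    "\<And>v. norm v \<le> 1 \<Longrightarrow> (\<And>f. f \<in> \<Phi> \<Longrightarrow> \<bar>f v - f 0\<bar> < e) \<Longrightarrow> v \<in> U"
    using weak_unit_ball_neighbourhood[OF U(1,2)] by metis
  obtain V :: "nat filter" where V: "V \<le> sequentially" "ultra V"
    using ultra_exists[OF sequentially_bot] .
  have "\<exists>c. ((\<lambda>n. f (x n)) \<longlongrightarrow> c) V" if f: "f \<in> \<Phi>" for f
  proof -
    obtain C where C: "C > 0" "bdd_functional C f"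
      using bounded_linear_bdd_functional[OF \<Phi>(2)[OF f]] .
    have "\<bar>f (x n)\<bar> \<le> C * (1 / 2)" for n
      using bdd_functional_abs_le[OF C(2), of "x n"] mult_left_mono[OF x[of n], of C] C(1) by linarith
    then show ?thesis
      using ultra_tendsto_bounded[OF V(2), of "\<lambda>n. f (x n)" "C * (1 / 2)"] by metis
  qed
  then obtain c where c: "\<And>f. f \<in> \<Phi> \<Longrightarrow> ((\<lambda>n. f (x n)) \<longlongrightarrow> c f) V" by metis
  have "eventually (\<lambda>n. \<forall>f\<in>\<Phi>. dist (f (x n)) (c f) < e / 2) V"
    using \<Phi>(1,3) c by (intro eventually_ball_finite ballI tendstoD) auto
  then have inf: "infinite {n. \<forall>f\<in>\<Phi>. dist (f (x n)) (c f) < e / 2}" (is "infinite ?S")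
    by (rule ultra_sequentially_infinite[OF V(1) ultra_nonbot[OF V(2)]])
  then have "?S \<noteq> {}" by (rule infinite_imp_nonempty)
  then obtain i where i: "i \<in> ?S" by blast
  have "?S - {..i} \<subseteq> {n. (\<lambda>i. x n - x i) ` {..<n} \<inter> U \<noteq> {}}"
  proof
    fix n assume n: "n \<in> ?S - {..i}"
    have "x n - x i \<in> U"
    proof (rule \<Phi>(4))
      show "norm (x n - x i) \<le> 1"
        using norm_triangle_ineq4[of "x n" "x i"] x[of n] x[of i] by linarith
      fix f assume f: "f \<in> \<Phi>"
      have "\<bar>f (x n) - f (x i)\<bar> < e"
        using n i f dist_triangle_half_l[of "f (x n)" "c f" e "f (x i)"]
        by (auto simp: dist_real_def dist_commute)
      moreover have "f (x n - x i) - f 0 = f (x n) - f (x i)"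
        using bounded_linear.linear[OF \<Phi>(2)[OF f]] by (simp add: linear_diff linear_0)
      ultimately show "\<bar>f (x n - x i) - f 0\<bar> < e" by simp
    qed
    moreover have "x n - x i \<in> (\<lambda>i. x n - x i) ` {..<n}" using n by auto
    ultimately show "n \<in> {n. (\<lambda>i. x n - x i) ` {..<n} \<inter> U \<noteq> {}}" by blast
  qed
  with U(3) have "finite (?S - {..i})" by (rule finite_subset[rotated])
  with inf show False by (simp add: Diff_infinite_finite)
qed

text \<open>The functionals \<open>\<phi> n\<close> biorthogonal to the sequence are averages, over all sign patterns
  \<open>A\<close>, of Hahn--Banach functionals \<open>f A\<close> with \<open>f A (x i) = rademacher i A\<close>, weighted by
  \<open>rademacher n\<close>. Bessel's inequality makes them weak-star null, and their smallness on weakly null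
  sequences is uniform in \<open>n\<close>.\<close>

lemma ell1_biorthogonal:
  fixes x :: "nat \<Rightarrow> 'a::real_normed_vector"
  assumes d: "d > 0" and x: "ell1_lower_bound d x"
  obtains \<phi> where "\<And>n. bounded_linear (\<phi> n :: 'a \<Rightarrow> real)"
    "\<And>n i. \<phi> n (x i) = (if i = n then 1 else 0)"
    "\<And>y. (\<lambda>n. \<phi> n y) \<longlonglongrightarrow> 0"
    "\<And>z e B. (\<And>j. norm (z j) \<le> B) \<Longrightarrow> e > 0 \<Longrightarrow>
       (\<And>g. bounded_linear g \<Longrightarrow> (\<lambda>j. g (z j) :: real) \<longlonglongrightarrow> 0) \<Longrightarrow> \<exists>j::nat. \<forall>n. \<bar>\<phi> n (z j)\<bar> < e"
proof -
  define C where "C = 1 / d"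
  have C: "C > 0" using d by (simp add: C_def)
  have "\<exists>f. bdd_functional C f \<and> (\<forall>i. f (x i) = rademacher i A)" for A
    using ell1_functional[OF d x, of "\<lambda>i. rademacher i A"] abs_rademacher unfolding C_def
    by (metis order_refl)
  then obtain f where f: "\<And>A. bdd_functional C (f A)" "\<And>A i. f A (x i) = rademacher i A" by metis
  note f_le = bdd_functional_abs_le[OF f(1)]
  obtain V :: "nat filter" where V: "V \<le> sequentially" "ultra V"
    using ultra_exists[OF sequentially_bot] .
  note V' = ultra_nonbot[OF V(2)]
  define \<psi> where "\<psi> N n y = avg N (\<lambda>A. rademacher n A * f A y)" for N n y
  have \<psi>_le: "\<bar>\<psi> N n y\<bar> \<le> avg N (\<lambda>A. \<bar>f A y\<bar>)" for N n y
    unfolding \<psi>_def using avg_abs[of N "\<lambda>A. rademacher n A * f A y"]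
    by (simp add: abs_mult abs_rademacher)
  have \<psi>: "bdd_functional C (\<psi> N n)" for N n
    unfolding bdd_functional_def
  proof (intro conjI allI)
    show "linear (\<psi> N n)"
    proof (rule linearI)
      show "\<psi> N n (y + z) = \<psi> N n y + \<psi> N n z" for y z
        by (simp add: \<psi>_def linear_add[OF bdd_functional_linear[OF f(1)]] distrib_left avg_add)
      have "(\<lambda>A. rademacher n A * (c * f A y)) = (\<lambda>A. c * (rademacher n A * f A y))" for c y
        by (simp add: fun_eq_iff)
      then show "\<psi> N n (c *\<^sub>R y) = c *\<^sub>R \<psi> N n y" for c y
        by (simp add: \<psi>_def linear_scale[OF bdd_functional_linear[OF f(1)]] avg_mult)
    qed
    show "\<bar>\<psi> N n y\<bar> \<le> C * norm y" for y
      using \<psi>_le[of N n y] avg_mono[of "\<lambda>A. \<bar>f A y\<bar>" "\<lambda>_. C * norm y" N] f_le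
      by (simp add: avg_const)
  qed
  have "\<exists>g. bdd_functional C g \<and> (\<forall>y. ((\<lambda>N. \<psi> N n y) \<longlongrightarrow> g y) V)" for n
    using bdd_functional_ultralimit[OF V(2), of C "\<lambda>N. \<psi> N n"] \<psi> by metis
  then obtain \<phi> where \<phi>: "\<And>n. bdd_functional C (\<phi> n)" "\<And>n y. ((\<lambda>N. \<psi> N n y) \<longlongrightarrow> \<phi> n y) V"
    by metis
  \<comment> \<open>The charge is a limit along the same \<open>V\<close> as the functionals, so
    estimates between averages at stage \<open>N\<close> carry over to \<open>\<mu>\<close> and
    \<open>\<phi>\<close>.\<close>
  obtain \<mu> where \<mu>: "charge \<mu>" "\<And>E. ((\<lambda>N. avg N (indicator E)) \<longlongrightarrow> \<mu> E) V"
    using charge_avg_ultralimit[OF V(2)] by metis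
  show ?thesis
  proof (rule that)
    show "bounded_linear (\<phi> n)" for n
      by (rule bdd_functional_bounded_linear[OF \<phi>(1)])
    show "\<phi> n (x i) = (if i = n then 1 else 0)" for n i
    proof (rule tendsto_unique[OF V' \<phi>(2)])
      have "eventually (\<lambda>N. n < N) V" by (rule filter_leD[OF V(1) eventually_gt_at_top])
      then have "eventually (\<lambda>N. \<psi> N n (x i) = (if i = n then 1 else 0)) V"
        by eventually_elim (auto simp: \<psi>_def f(2) rademacher_square avg_const avg_rademacher_mult)
      then show "((\<lambda>N. \<psi> N n (x i)) \<longlongrightarrow> (if i = n then 1 else 0)) V"
        by (rule tendsto_eventually)
    qed
    show "(\<lambda>n. \<phi> n y) \<longlonglongrightarrow> 0" for y
    proof -
      have "(\<Sum>n<k. (\<phi> n y)\<^sup>2) \<le> (C * norm y)\<^sup>2" for k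
      proof (rule tendsto_upperbound[OF _ _ V'])
        show "((\<lambda>N. \<Sum>n<k. (\<psi> N n y)\<^sup>2) \<longlongrightarrow> (\<Sum>n<k. (\<phi> n y)\<^sup>2)) V"
          by (intro tendsto_intros \<phi>(2))
        have "eventually (\<lambda>N. k \<le> N) V" by (rule filter_leD[OF V(1) eventually_ge_at_top])
        then show "eventually (\<lambda>N. (\<Sum>n<k. (\<psi> N n y)\<^sup>2) \<le> (C * norm y)\<^sup>2) V"
        proof eventually_elim
          case (elim N)
          have "(\<Sum>n<k. (\<psi> N n y)\<^sup>2) \<le> avg N (\<lambda>A. (f A y)\<^sup>2)"
            unfolding \<psi>_def using elim by (intro avg_bessel) auto
          also have "\<dots> \<le> avg N (\<lambda>_. (C * norm y)\<^sup>2)"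
            using f_le by (intro avg_mono) (simp add: abs_le_square_iff[symmetric] abs_mult C less_imp_le)
          finally show ?case by (simp add: avg_const)
        qed
      qed
      then have "summable (\<lambda>n. (\<phi> n y)\<^sup>2)"
        by (intro summableI_nonneg_bounded) auto
      then have "(\<lambda>n. (\<phi> n y)\<^sup>2) \<longlonglongrightarrow> 0" by (rule summable_LIMSEQ_zero)
      then show ?thesis by (simp add: tendsto_null_power)
    qed
    fix z :: "nat \<Rightarrow> 'a" and e B :: real
    assume B: "\<And>j. norm (z j) \<le> B" and e: "e > 0"
      and null: "\<And>g. bounded_linear g \<Longrightarrow> (\<lambda>j. g (z j) :: real) \<longlonglongrightarrow> 0"
    have "B \<ge> 0" using B[of 0] norm_ge_zero order_trans by blast
    \<comment> \<open>Patterns whose value at \<open>z j\<close> reaches \<open>e / 3\<close>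
      contribute at most \<open>C * B * c\<close>, thus at most \<open>e / 3\<close>, and the others
      at most \<open>e / 3\<close>. The \<open>+ 1\<close> keeps the denominator positive when
      \<open>B = 0\<close>.\<close>
    define c where "c = e / (3 * (C * B + 1))"
    have CB: "C * B + 1 > 0" using C \<open>B \<ge> 0\<close> by (simp add: add_nonneg_pos)
    then have c: "c > 0" using e by (simp add: c_def)
    have "\<exists>j. \<mu> {A. \<bar>f A (z j)\<bar> \<ge> e / 3} < c"
      using \<mu>(1) f(1) null by (rule weakly_null_charge) (use e c in simp_all)
    then obtain j where j: "\<mu> {A. \<bar>f A (z j)\<bar> \<ge> e / 3} < c" ..
    let ?E = "{A. \<bar>f A (z j)\<bar> \<ge> e / 3}"
    have "\<bar>\<phi> n (z j)\<bar> < e" for n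
    proof -
      have "\<bar>\<phi> n (z j)\<bar> \<le> e / 3 + C * B * \<mu> ?E"
      proof (rule tendsto_le[OF V'])
        show "((\<lambda>N. \<bar>\<psi> N n (z j)\<bar>) \<longlongrightarrow> \<bar>\<phi> n (z j)\<bar>) V"
          by (intro tendsto_intros \<phi>(2))
        show "((\<lambda>N. e / 3 + C * B * avg N (indicator ?E)) \<longlongrightarrow> e / 3 + C * B * \<mu> ?E) V"
          by (intro tendsto_intros \<mu>(2))
        have "\<bar>f A (z j)\<bar> \<le> e / 3 + C * B * indicator ?E A" for A
        proof (cases "A \<in> ?E")
          case True
          have "\<bar>f A (z j)\<bar> \<le> C * B"
            using f_le[of A "z j"] mult_left_mono[OF B[of j], of C] C by linarith
          then show ?thesis using True e by simp
        qed (use e in auto)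
        then have "avg N (\<lambda>A. \<bar>f A (z j)\<bar>) \<le> avg N (\<lambda>A. e / 3 + C * B * indicator ?E A)" for N
          by (rule avg_mono)
        then have "\<bar>\<psi> N n (z j)\<bar> \<le> e / 3 + C * B * avg N (indicator ?E)" for N
          using \<psi>_le[of N n "z j"] order_trans by (fastforce simp: avg_add avg_const avg_mult)
        then show "eventually (\<lambda>N. \<bar>\<psi> N n (z j)\<bar> \<le> e / 3 + C * B * avg N (indicator ?E)) V"
          by simp
      qed
      also have "C * B * \<mu> ?E \<le> (C * B + 1) * c"
        using j C \<open>B \<ge> 0\<close> charge_nonneg[OF \<mu>(1), of ?E] by (intro mult_mono) auto
      also have "(C * B + 1) * c = e / 3"
        using CB by (simp add: c_def field_simps)
      finally show ?thesis using e by linarith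
    qed
    then show "\<exists>j. \<forall>n. \<bar>\<phi> n (z j)\<bar> < e" by blast
  qed
qed

lemma strong_fan_if_ell1:
  fixes x :: "nat \<Rightarrow> 'a::real_normed_vector"
  assumes d: "d > 0" and lower: "ell1_lower_bound d x" and x: "\<And>n. norm (x n) \<le> 1 / 2"
  shows "strong_Fin_omega_fan weak_unit_ball (\<lambda>n. (\<lambda>i. x n - x i) ` {..<n})"
proof (rule ell1_biorthogonal[OF d lower])
  let ?Y = "weak_unit_ball :: 'a topology"
  let ?F = "\<lambda>n. (\<lambda>i. x n - x i) ` {..<n}"
  fix \<phi>
  assume \<phi>: "\<And>n. bounded_linear (\<phi> n :: 'a \<Rightarrow> real)"
    "\<And>n i. \<phi> n (x i) = (if i = n then 1 else 0)"
    and \<phi>_null: "\<And>y. (\<lambda>n. \<phi> n y) \<longlonglongrightarrow> 0"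
    and \<phi>_unif: "\<And>z e B. (\<And>j. norm (z j) \<le> B) \<Longrightarrow> e > 0 \<Longrightarrow>
       (\<And>g. bounded_linear g \<Longrightarrow> (\<lambda>j. g (z j) :: real) \<longlonglongrightarrow> 0) \<Longrightarrow> \<exists>j::nat. \<forall>n. \<bar>\<phi> n (z j)\<bar> < e"
  note \<phi>_diff = linear_diff[OF bounded_linear.linear[OF \<phi>(1)]]
  define U where "U n = {y \<in> cball 0 1. \<bar>\<phi> n y\<bar> > 1 / 2}" for n
  have F: "?F n \<subseteq> cball 0 1" for n
  proof
    fix v assume "v \<in> ?F n"
    then obtain i where "v = x n - x i" by blast
    then show "v \<in> cball 0 1"
      using norm_triangle_ineq4[of "x n" "x i"] x[of n] x[of i] by simp
  qed
  have FU: "?F n \<subseteq> U n" for n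
    using F[of n] by (auto simp: U_def \<phi>_diff \<phi>(2))
  have cfU: "compact_finite_family ?Y U"
    unfolding compact_finite_family_def
  proof (intro allI impI, rule ccontr)
    fix K assume K: "compactin ?Y K" and "infinite {n. U n \<inter> K \<noteq> {}}"
    then obtain m :: "nat \<Rightarrow> nat" where m: "strict_mono m" "\<And>k. U (m k) \<inter> K \<noteq> {}"
      using infinite_enumerate[of "{n. U n \<inter> K \<noteq> {}}"] by blast
    then have "\<forall>k. \<exists>v. v \<in> U (m k) \<inter> K" by blast
    then have "\<exists>y. \<forall>k. y k \<in> U (m k) \<inter> K" by (rule choice)
    then obtain y where y: "\<And>k. y k \<in> U (m k)" "\<And>k. y k \<in> K" by blast
    obtain V :: "nat filter" where V: "V \<le> sequentially" "ultra V"
      using ultra_exists[OF sequentially_bot] .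
    obtain l where l: "l \<in> K" "\<And>f::'a \<Rightarrow> real. bounded_linear f \<Longrightarrow> ((\<lambda>n. f (y n)) \<longlongrightarrow> f l) V"
      using weakly_compact_ultralimit[of V K y, OF V(2) K y(2)] by blast
    have norm_K: "norm v \<le> 1" if "v \<in> K" for v
      using compactin_subset_topspace[OF K] that by auto
    show False
    proof (rule weakly_null_or_ell1_subsequence[OF V(2,1), of "\<lambda>n. y n - l"])
      fix f :: "'a \<Rightarrow> real" assume f: "bounded_linear f"
      show "((\<lambda>n. f (y n - l)) \<longlongrightarrow> 0) V"
        using LIM_zero[OF l(2)[OF f]] by (simp add: linear_diff[OF bounded_linear.linear[OF f]])
    next
      fix r :: "nat \<Rightarrow> nat"
      assume r: "strict_mono r" "\<And>f::'a \<Rightarrow> real. bounded_linear f \<Longrightarrow> (\<lambda>n. f (y (r n) - l)) \<longlonglongrightarrow> 0"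
      \<comment> \<open>Passing from \<open>y\<close> to the weakly null \<open>y - l\<close> costs
        the values of the functionals at \<open>l\<close>, which weak-star nullity makes
        small.\<close>
      have "strict_mono (m \<circ> r)"
        using m(1) r(1) by (rule strict_mono_o)
      then have "((\<lambda>n. \<phi> n l) \<circ> (m \<circ> r)) \<longlonglongrightarrow> 0"
        by (rule LIMSEQ_subseq_LIMSEQ[OF \<phi>_null])
      from tendstoD[OF this, of "1 / 4"]
      have "eventually (\<lambda>k. \<bar>\<phi> (m (r k)) l\<bar> < 1 / 4) sequentially"
        by (simp add: comp_def dist_real_def)
      then obtain k0 where k0: "\<And>k. k \<ge> k0 \<Longrightarrow> \<bar>\<phi> (m (r k)) l\<bar> < 1 / 4"
        by (auto simp: eventually_sequentially)
      \<comment> \<open>Uniform smallness yields one unspecified index \<open>j\<close>, so the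
        sequence is cut at \<open>k0\<close> beforehand. Two values below \<open>1 / 4\<close> then
        contradict one above \<open>1 / 2\<close>.\<close>
      define z where "z j = y (r (j + k0)) - l" for j
      have "norm (z j) \<le> 2" for j
        using norm_triangle_ineq4[of "y (r (j + k0))" l] norm_K[OF y(2)[of "r (j + k0)"]] norm_K[OF l(1)]
        unfolding z_def by linarith
      moreover have "(\<lambda>j. f (z j)) \<longlonglongrightarrow> 0" if "bounded_linear f" for f :: "'a \<Rightarrow> real"
        unfolding z_def by (rule LIMSEQ_ignore_initial_segment[OF r(2)[OF that]])
      ultimately obtain j where "\<bar>\<phi> (m (r (j + k0))) (z j)\<bar> < 1 / 4"
        using \<phi>_unif[of z 2 "1 / 4"] by auto
      moreover have "\<bar>\<phi> (m (r (j + k0))) (y (r (j + k0)))\<bar> > 1 / 2"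
        using y(1)[of "r (j + k0)"] by (simp add: U_def)
      moreover have "\<bar>\<phi> (m (r (j + k0))) l\<bar> < 1 / 4" by (rule k0) simp
      ultimately show False
        unfolding z_def \<phi>_diff by linarith
    next
      fix r :: "nat \<Rightarrow> nat" and c assume "c > 0" "ell1_lower_bound c (\<lambda>n. y (r n) - l)"
      then show False
        using weakly_compact_no_ell1[OF K, of "\<lambda>n. y (r n)" c l] y(2) by blast
    qed
  qed
  have "compact_finite_family ?Y ?F"
    unfolding compact_finite_family_def
  proof (intro allI impI)
    fix K assume "compactin ?Y K"
    then have "finite {n. U n \<inter> K \<noteq> {}}"
      using cfU by (simp add: compact_finite_family_def)
    then show "finite {n. ?F n \<inter> K \<noteq> {}}"
      by (rule rev_finite_subset) (use FU in blast)
  qed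
  then have "Fin_omega_fan ?Y ?F"
    unfolding Fin_omega_fan_def using F differences_not_locally_finite[OF x] by simp
  moreover have "R_open ?Y (U n)" for n
    unfolding U_def by (rule R_open_functional[OF \<phi>(1)])
  ultimately show "strong_Fin_omega_fan ?Y ?F"
    unfolding strong_Fin_omega_fan_def using FU cfU by blast
qed

lemma ell1_lower_bound_scaleR:
  assumes "ell1_lower_bound d x" "t \<ge> 0"
  shows "ell1_lower_bound (t * d) (\<lambda>n. t *\<^sub>R x n)"
  unfolding ell1_lower_bound_def
proof (intro allI impI)
  fix I :: "'a set" and c :: "'a \<Rightarrow> real" assume I: "finite I"
  have "t * (d * (\<Sum>i\<in>I. \<bar>c i\<bar>)) \<le> t * norm (\<Sum>i\<in>I. c i *\<^sub>R x i)"
    using assms(2) by (intro mult_left_mono ell1_lower_boundD[OF assms(1) I])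
  also have "\<dots> = norm (t *\<^sub>R (\<Sum>i\<in>I. c i *\<^sub>R x i))"
    using assms(2) by simp
  also have "t *\<^sub>R (\<Sum>i\<in>I. c i *\<^sub>R x i) = (\<Sum>i\<in>I. c i *\<^sub>R t *\<^sub>R x i)"
    by (simp add: scaleR_sum_right mult.commute)
  finally show "t * d * (\<Sum>i\<in>I. \<bar>c i\<bar>) \<le> norm (\<Sum>i\<in>I. c i *\<^sub>R t *\<^sub>R x i)"
    by (simp add: mult.assoc)
qed

theorem theorem1p14:
  shows "(frechet_urysohn_space (weak_unit_ball :: 'a::banach topology)
            \<longleftrightarrow> (\<nexists>F. strong_Fin_omega_fan (weak_unit_ball :: 'a topology) F))
       \<and> ((\<nexists>F. strong_Fin_omega_fan (weak_unit_ball :: 'a topology) F)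
            \<longleftrightarrow> (\<nexists>S :: 'a set. isomorphic_copy TYPE(ell1) S))"
proof -
  have 12: "\<nexists>F. strong_Fin_omega_fan (weak_unit_ball :: 'a topology) F"
    if "frechet_urysohn_space (weak_unit_ball :: 'a topology)"
    using frechet_urysohn_no_fan[OF that] by (auto simp: strong_Fin_omega_fan_def)
  have 23: "\<exists>F. strong_Fin_omega_fan (weak_unit_ball :: 'a topology) F"
    if copy: "isomorphic_copy TYPE(ell1) S" for S :: "'a set"
  proof -
    obtain x :: "nat \<Rightarrow> 'a" and d where x: "d > 0" "\<And>n. norm (x n) \<le> 1" "ell1_lower_bound d x"
      using isomorphic_copy_ell1D[OF copy] by blast
    \<comment> \<open>Halving the terms puts all their differences into the unit ball.\<close>
    have "strong_Fin_omega_fan weak_unit_ball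
        (\<lambda>n. (\<lambda>i. (1 / 2) *\<^sub>R x n - (1 / 2) *\<^sub>R x i) ` {..<n})"
      by (rule strong_fan_if_ell1[of "1 / 2 * d"])
         (use x ell1_lower_bound_scaleR[OF x(3), of "1 / 2"] in auto)
    then show ?thesis by blast
  qed
  have 31: "frechet_urysohn_space (weak_unit_ball :: 'a topology)"
    if "\<nexists>S :: 'a set. isomorphic_copy TYPE(ell1) S"
  proof (rule frechet_urysohn_weak_unit_ball)
    fix x :: "nat \<Rightarrow> 'a" and d :: real
    assume x: "\<And>n. norm (x n) \<le> 2" "d > 0"
    show "\<not> ell1_lower_bound d x"
    proof
      assume lower: "ell1_lower_bound d x"
      obtain S :: "'a set" where "isomorphic_copy TYPE(ell1) S"
        using isomorphic_copy_ell1I[OF x(2,1) lower] by blast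
      with that show False by blast
    qed
  qed
  show ?thesis using 12 23 31 by blast
qed

end
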